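(* Let $n\geq 3$ be an integer, let $k$ be any field, and let $A=k[X_1,\ldots,X_n;Y_1,\ldots,Y_n]$ be the polynomial ring in $2n$ variables over $k$. Let $f=\sum_{i=1}^n X_iY_i-1\in A$ and let $I=Af$ be the principal ideal generated by $f$. Then the images $\overline{X_1f},\overline{X_2f},\ldots,\overline{X_nf}$ of $X_1f,\ldots,X_nf$ in $I/I^2$ generate $I/I^2$, but this set of generators of $I/I^2$ does not lift to a set of generators of $I$; that is, there do not exist $g_1,\ldots,g_n\in I$ such that $I=(g_1,\ldots,g_n)$ and $g_i-X_if\in I^2$ for all $i=1,\ldots,n$.
   Context: For an element of $I$, an overline denotes its image in $I/I^2$. Generators $\overline{a_1},\ldots,\overline{a_n}$ of $I/I^2$ (as a module) are said to lift to a set of generators of $I$ if there are $g_1,\ldots,g_n\in I$ generating the ideal $I$ such that the image of $g_i$ in $I/I^2$ is $\overline{a_i}$ for each $i$. *)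

theory Defs
  imports
    Complex_Main
    "HOL-Library.Poly_Mapping"
    "HOL-Library.Set_Algebras"
    "HOL-Library.Cardinality"
begin

section \<open>Ideals of a commutative ring\<close>

text \<open>A commutative ring is a module over itself; its submodules are the ideals.\<close>

interpretation ideal: module "(*) :: 'a::comm_ring_1 \<Rightarrow> 'a \<Rightarrow> 'a"
  by standard (simp_all add: algebra_simps)

abbreviation ideal_gen :: "'a::comm_ring_1 set \<Rightarrow> 'a set"
  where "ideal_gen S \<equiv> module.span (*) S"

definition ideal_square :: "'a::comm_ring_1 set \<Rightarrow> 'a set"
  where "ideal_square I = ideal_gen {a * b | a b. a \<in> I \<and> b \<in> I}"

section \<open>The quotient module of an ideal by a smaller ideal\<close>

text \<open>
  The class of \<open>a\<close> modulo the ideal \<open>J\<close> is the coset \<open>a +o J\<close>, and \<open>I/J\<close> is the set of classes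
  of elements of \<open>I\<close>. Addition of classes is the elementwise sum of sets. The elementwise multiple
  \<open>r *o (a +o J)\<close> is in general only a part of a coset, and adding \<open>J\<close> completes it to the class
  of \<open>r * a\<close>; see \<open>coset_plus\<close> and \<open>coset_scale\<close> below.
\<close>

definition ideal_quotient :: "'a::comm_ring_1 set \<Rightarrow> 'a set \<Rightarrow> 'a set set"
  where "ideal_quotient I J = (\<lambda>a. a +o J) ` I"

definition class_scale :: "'a::comm_ring_1 set \<Rightarrow> 'a \<Rightarrow> 'a set \<Rightarrow> 'a set"
  where "class_scale J r C = r *o C + J"

text \<open>
  In \<open>generates_quotient\<close> the summand \<open>J\<close> is the zero of the quotient (the zero that \<open>sum\<close> uses
  for sets is \<open>{0}\<close>).
\<close>

definition generates_quotient ::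
    "'a::comm_ring_1 set \<Rightarrow> 'a set \<Rightarrow> ('i::finite \<Rightarrow> 'a set) \<Rightarrow> bool"
  where "generates_quotient I J c \<longleftrightarrow>
    range c \<subseteq> ideal_quotient I J \<and>
    (\<forall>C \<in> ideal_quotient I J. \<exists>r. C = J + (\<Sum>i\<in>UNIV. class_scale J (r i) (c i)))"

definition lifts_to_generators ::
    "'a::comm_ring_1 set \<Rightarrow> ('i::finite \<Rightarrow> 'a set) \<Rightarrow> bool"
  where "lifts_to_generators I c \<longleftrightarrow>
    (\<exists>g. range g \<subseteq> I \<and> ideal_gen (range g) = I \<and> (\<forall>i. g i +o ideal_square I = c i))"

lemma coset_plus:
  assumes "ideal.subspace J"
  shows "(a +o J) + (b +o J) = (a + b) +o J"
proof -
  have "J + J = J"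
    using ideal.subspace_add[OF assms] ideal.subspace_0[OF assms]
    by (force simp: set_plus_def)
  then show ?thesis
    by (simp add: set_plus_rearrange)
qed

lemma coset_scale:
  assumes "ideal.subspace J"
  shows "class_scale J r (a +o J) = (r * a) +o J"
proof -
  have "r *o J + J = J"
    using ideal.subspace_add[OF assms] ideal.subspace_0[OF assms] ideal.subspace_scale[OF assms]
    by (force simp: set_plus_def elt_set_times_def)
  then show ?thesis
    by (simp add: class_scale_def set_times_plus_distrib set_plus_rearrange3)
qed

lemma coset_eq_iff:
  assumes "ideal.subspace J"
  shows "a +o J = b +o J \<longleftrightarrow> a - b \<in> J"
proof
  assume "a +o J = b +o J"
  moreover have "a \<in> a +o J"
    using ideal.subspace_0[OF assms] by (force simp: elt_set_plus_def)
  ultimately show "a - b \<in> J"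
    by (auto simp: elt_set_plus_def)
next
  assume ab: "a - b \<in> J"
  have "x +o J \<subseteq> y +o J" if "x - y \<in> J" for x y
  proof
    fix z assume "z \<in> x +o J"
    then obtain j where "j \<in> J" "z = x + j" by (auto simp: elt_set_plus_def)
    with that have "(x - y) + j \<in> J" "z = y + ((x - y) + j)"
      using ideal.subspace_add[OF assms] by auto
    then show "z \<in> y +o J" unfolding elt_set_plus_def by blast
  qed
  moreover have "b - a \<in> J"
    using ideal.subspace_neg[OF assms ab] by simp
  ultimately show "a +o J = b +o J" using ab by blast
qed

lemma lifts_to_generators_iff:
  "lifts_to_generators I (\<lambda>i. a i +o ideal_square I) \<longleftrightarrow>
    (\<exists>g. (\<forall>i. g i \<in> I) \<and> I = ideal_gen (range g) \<and> (\<forall>i. g i - a i \<in> ideal_square I))"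
  unfolding lifts_to_generators_def
  by (auto simp: ideal_square_def coset_eq_iff image_subset_iff)

section \<open>Polynomials in two families of variables indexed by \<open>'n\<close>\<close>

type_synonym ('n, 'k) two_family_poly = "('n + 'n \<Rightarrow>\<^sub>0 nat) \<Rightarrow>\<^sub>0 'k"

definition X :: "'n \<Rightarrow> ('n, 'k::comm_ring_1) two_family_poly"
  where "X i = Poly_Mapping.single (Poly_Mapping.single (Inl i) 1) 1"

definition Y :: "'n \<Rightarrow> ('n, 'k::comm_ring_1) two_family_poly"
  where "Y i = Poly_Mapping.single (Poly_Mapping.single (Inr i) 1) 1"

end

theory Submission
  imports
    Defs
    "HOL-Analysis.Determinants"
    "HOL-Computational_Algebra.Primes"
begin

text \<open>
  A lift \<open>g\<^sub>i = f h\<^sub>i\<close> makes \<open>h = (h\<^sub>1, \<dots>, h\<^sub>n)\<close> a unimodular row over \<open>A\<close> with \<open>h\<^sub>i \<equiv> X\<^sub>i\<close>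
  modulo \<open>f\<close>. If \<open>\<Sum> h\<^sub>i r\<^sub>i = 1\<close>, then \<open>u\<^sub>i = Y\<^sub>i + r\<^sub>i (1 - \<Sum> Y\<^sub>j h\<^sub>j)\<close> satisfies
  \<open>\<Sum> h\<^sub>i u\<^sub>i = 1\<close> and \<open>u\<^sub>i \<equiv> Y\<^sub>i\<close>, so \<open>(h, u)\<close> is a polynomial retraction of affine space onto
  the quadric \<open>f = 0\<close>, and Brouwer's argument applies. The Jacobian of \<open>(h, u)\<close> vanishes because
  of the relation \<open>\<Sum> h\<^sub>i u\<^sub>i = 1\<close>. On the other hand let \<open>M\<close> be the functional on polynomials
  that maps \<open>X\<^sup>a Y\<^sup>b\<close> to \<open>a! / (n + |a|)!\<close> if \<open>a = b\<close> and to 0 otherwise (the integral over the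
  complex unit ball with \<open>Y\<close> the conjugate of \<open>X\<close>). It kills every partial derivative of a multiple
  of \<open>f\<close>, so the value of \<open>M\<close> on the Jacobian depends only on \<open>(h, u)\<close> modulo \<open>f\<close> and equals
  \<open>M 1 = 1 / n!\<close>.

  In characteristic \<open>p\<close> the denominators of \<open>M\<close> are handled by lifting the coefficients to
  \<open>\<int>[T\<^sub>x | x \<in> k]\<close>, with kernel \<open>\<mm>\<close> of the evaluation at \<open>T\<^sub>x = x\<close>. A geometric series
  makes the relation hold modulo \<open>\<mm>\<^sup>N\<close> at the cost of degree \<open>O(N)\<close>. Clearing denominators in
  this degree puts an integer whose \<open>p\<close>-adic valuation is \<open>O(log N)\<close> into \<open>\<mm>\<^sup>N\<close>, whereas a lift of
  Frobenius shows that every integer in \<open>\<mm>\<^sup>N\<close> is divisible by \<open>p\<^sup>N\<close>.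
\<close>

declare ideal.scale_scale [simp del] \<comment> \<open>reassociates products and loops with \<open>mult_ac\<close>\<close>

section \<open>Polynomials as sums of terms, and homomorphisms out of monoid rings\<close>

lemma sum_single_keys:
  fixes P :: "'m \<Rightarrow>\<^sub>0 'a::comm_monoid_add"
  shows "P = (\<Sum>m\<in>Poly_Mapping.keys P. Poly_Mapping.single m (Poly_Mapping.lookup P m))"
proof (rule poly_mapping_eqI)
  fix k
  show "Poly_Mapping.lookup P k =
    Poly_Mapping.lookup (\<Sum>m\<in>Poly_Mapping.keys P. Poly_Mapping.single m (Poly_Mapping.lookup P m)) k"
    by (simp add: lookup_sum lookup_single when_def in_keys_iff)
qed

text \<open>The first premise ranges only over the terms of \<open>P\<close> itself, so that a bound
  on the degree or on the coefficients of \<open>P\<close> stays available in the case of a single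
  term.\<close>

lemma poly_mapping_single_induct [case_names single zero add]:
  fixes P :: "'m \<Rightarrow>\<^sub>0 'a::comm_monoid_add"
  assumes "\<And>m. m \<in> Poly_Mapping.keys P \<Longrightarrow> Q (Poly_Mapping.single m (Poly_Mapping.lookup P m))"
    and "Q 0" and "\<And>a b. Q a \<Longrightarrow> Q b \<Longrightarrow> Q (a + b)"
  shows "Q P"
proof -
  have "Q (\<Sum>m\<in>S. Poly_Mapping.single m (Poly_Mapping.lookup P m))"
    if "finite S" "S \<subseteq> Poly_Mapping.keys P" for S
    using that by (induction S) (auto intro: assms)
  then show ?thesis
    by (metis finite_keys order_refl sum_single_keys)
qed

definition sum_terms ::
    "('m \<Rightarrow> 'a::comm_monoid_add \<Rightarrow> 'b::comm_monoid_add) \<Rightarrow> ('m \<Rightarrow>\<^sub>0 'a) \<Rightarrow> 'b"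
  where "sum_terms T P = (\<Sum>m\<in>Poly_Mapping.keys P. T m (Poly_Mapping.lookup P m))"

lemma sum_terms_zero [simp]: "sum_terms T 0 = 0"
  by (simp add: sum_terms_def)

lemma sum_terms_single: "T m 0 = 0 \<Longrightarrow> sum_terms T (Poly_Mapping.single m c) = T m c"
  by (simp add: sum_terms_def)

lemma sum_terms_add:
  assumes "\<And>m. T m 0 = 0" "\<And>m a b. T m (a + b) = T m a + T m b"
  shows "sum_terms T (P + Q) = sum_terms T P + sum_terms T Q"
  unfolding sum_terms_def by (rule setsum_keys_plus_distrib) (simp_all add: assms)

text \<open>One construction for three maps: reduction of coefficients, evaluation at field
  elements, and the lift of Frobenius.\<close>

definition poly_subst ::
    "('a::comm_ring_1 \<Rightarrow> 'b::comm_ring_1) \<Rightarrow> ('m::comm_monoid_add \<Rightarrow> 'b) \<Rightarrow> ('m \<Rightarrow>\<^sub>0 'a) \<Rightarrow> 'b"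
  where "poly_subst \<kappa> \<eta> = sum_terms (\<lambda>m c. \<kappa> c * \<eta> m)"

locale poly_subst_hom =
  fixes \<kappa> :: "'a::comm_ring_1 \<Rightarrow> 'b::comm_ring_1" and \<eta> :: "'m::comm_monoid_add \<Rightarrow> 'b"
  assumes \<kappa>_add: "\<kappa> (a + b) = \<kappa> a + \<kappa> b" and \<kappa>_mult: "\<kappa> (a * b) = \<kappa> a * \<kappa> b" and \<kappa>_1: "\<kappa> 1 = 1"
    and \<eta>_add: "\<eta> (m + m') = \<eta> m * \<eta> m'" and \<eta>_0: "\<eta> 0 = 1"
begin

lemma \<kappa>_0: "\<kappa> 0 = 0"
  using \<kappa>_add[of 0 0] by simp

lemma subst_single: "poly_subst \<kappa> \<eta> (Poly_Mapping.single m c) = \<kappa> c * \<eta> m"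
  by (simp add: poly_subst_def sum_terms_single \<kappa>_0)

lemma subst_add: "poly_subst \<kappa> \<eta> (P + Q) = poly_subst \<kappa> \<eta> P + poly_subst \<kappa> \<eta> Q"
  unfolding poly_subst_def by (rule sum_terms_add) (simp_all add: \<kappa>_0 \<kappa>_add distrib_right)

lemma subst_0: "poly_subst \<kappa> \<eta> 0 = 0"
  by (simp add: poly_subst_def)

lemma subst_1: "poly_subst \<kappa> \<eta> 1 = 1"
  using subst_single[of 0 1] by (simp add: \<kappa>_1 \<eta>_0)

lemma subst_mult: "poly_subst \<kappa> \<eta> (P * Q) = poly_subst \<kappa> \<eta> P * poly_subst \<kappa> \<eta> Q"
proof (induction P rule: poly_mapping_single_induct)
  case (single m)
  show ?case
  proof (induction Q rule: poly_mapping_single_induct)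
    case (single m')
    show ?case
      by (simp only: subst_single mult_single \<kappa>_mult \<eta>_add mult_ac)
  qed (simp_all add: subst_0 subst_add distrib_left)
qed (simp_all add: subst_0 subst_add distrib_right)

lemma subst_uminus: "poly_subst \<kappa> \<eta> (- P) = - poly_subst \<kappa> \<eta> P"
  using subst_add[of P "- P"] by (simp add: subst_0 eq_neg_iff_add_eq_0 add.commute)

lemma subst_diff: "poly_subst \<kappa> \<eta> (P - Q) = poly_subst \<kappa> \<eta> P - poly_subst \<kappa> \<eta> Q"
  using subst_add[of P "- Q"] by (simp add: subst_uminus)

lemma subst_sum: "poly_subst \<kappa> \<eta> (sum g A) = (\<Sum>x\<in>A. poly_subst \<kappa> \<eta> (g x))"
  by (induction A rule: infinite_finite_induct) (simp_all add: subst_0 subst_add)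

lemma subst_of_nat: "poly_subst \<kappa> \<eta> (of_nat n) = of_nat n"
  by (induction n) (simp_all add: subst_0 subst_1 subst_add)

lemma subst_of_int: "poly_subst \<kappa> \<eta> (of_int n) = of_int n"
  by (cases n) (simp_all add: subst_of_nat subst_uminus subst_diff subst_1)

end

section \<open>Total degree\<close>

type_synonym ('v, 'r) mpoly = "('v \<Rightarrow>\<^sub>0 nat) \<Rightarrow>\<^sub>0 'r"

definition total :: "('v::finite \<Rightarrow>\<^sub>0 nat) \<Rightarrow> nat"
  where "total m = (\<Sum>v\<in>UNIV. Poly_Mapping.lookup m v)"

lemma total_add: "total (m + m') = total m + total m'"
  by (simp add: total_def lookup_add sum.distrib)

lemma total_single [simp]: "total (Poly_Mapping.single v k) = k"
  by (simp add: total_def lookup_single when_def)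

lemma total_0 [simp]: "total 0 = 0"
  by (simp add: total_def)

definition deg_le :: "nat \<Rightarrow> ('v::finite, 'r::comm_ring_1) mpoly \<Rightarrow> bool"
  where "deg_le d P \<longleftrightarrow> (\<forall>m\<in>Poly_Mapping.keys P. total m \<le> d)"

lemma deg_le_0 [simp]: "deg_le d 0"
  by (simp add: deg_le_def)

lemma deg_le_single: "total m \<le> d \<Longrightarrow> deg_le d (Poly_Mapping.single m c)"
  by (simp add: deg_le_def)

lemma deg_le_1 [simp]: "deg_le d 1"
  by (simp add: deg_le_def)

lemma deg_le_mono: "deg_le d P \<Longrightarrow> d \<le> e \<Longrightarrow> deg_le e P"
  by (force simp: deg_le_def)

lemma deg_le_add: "deg_le d P \<Longrightarrow> deg_le d Q \<Longrightarrow> deg_le d (P + Q)"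
  using Poly_Mapping.keys_add[of P Q] by (auto simp: deg_le_def)

lemma deg_le_uminus: "deg_le d P \<Longrightarrow> deg_le d (- P)"
  by (auto simp: deg_le_def in_keys_iff)

lemma deg_le_diff: "deg_le d P \<Longrightarrow> deg_le d Q \<Longrightarrow> deg_le d (P - Q)"
  using deg_le_add[of d P "- Q"] by (simp add: deg_le_uminus)

lemma deg_le_sum: "(\<And>x. x \<in> A \<Longrightarrow> deg_le d (g x)) \<Longrightarrow> deg_le d (sum g A)"
  by (induction A rule: infinite_finite_induct) (simp_all add: deg_le_add)

lemma deg_le_mult: "deg_le d P \<Longrightarrow> deg_le e Q \<Longrightarrow> deg_le (d + e) (P * Q)"
  using Poly_Mapping.keys_mult[of P Q] by (fastforce simp: deg_le_def total_add intro: add_mono)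

lemma deg_le_prod:
  "(\<And>x. x \<in> A \<Longrightarrow> deg_le d (g x)) \<Longrightarrow> deg_le (card A * d) (prod g A)"
  by (induction A rule: infinite_finite_induct) (simp_all add: deg_le_mult)

lemma deg_le_power: "deg_le d P \<Longrightarrow> deg_le (n * d) (P ^ n)"
  by (induction n) (simp_all add: deg_le_mult)

lemma ex_deg_le: "\<exists>d. deg_le d P"
proof
  show "deg_le (Max (total ` Poly_Mapping.keys P)) P"
    by (auto simp: deg_le_def)
qed

section \<open>Coefficients in an ideal\<close>

text \<open>For an ideal \<open>I\<close> this is the extension of \<open>I\<close> to the
  polynomial ring.\<close>

definition coeffs_in :: "'r set \<Rightarrow> ('m \<Rightarrow>\<^sub>0 'r::comm_ring_1) set"
  where "coeffs_in I = {P. \<forall>m. Poly_Mapping.lookup P m \<in> I}"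

context
  fixes I :: "'r::comm_ring_1 set"
  assumes I: "ideal.subspace I"
begin

lemma coeffs_in_0: "0 \<in> coeffs_in I"
  using ideal.subspace_0[OF I] by (simp add: coeffs_in_def)

lemma coeffs_in_single: "c \<in> I \<Longrightarrow> Poly_Mapping.single m c \<in> coeffs_in I"
  using ideal.subspace_0[OF I] by (simp add: coeffs_in_def lookup_single when_def)

lemma coeffs_in_add: "P \<in> coeffs_in I \<Longrightarrow> Q \<in> coeffs_in I \<Longrightarrow> P + Q \<in> coeffs_in I"
  using ideal.subspace_add[OF I] by (simp add: coeffs_in_def lookup_add)

lemma coeffs_in_diff: "P \<in> coeffs_in I \<Longrightarrow> Q \<in> coeffs_in I \<Longrightarrow> P - Q \<in> coeffs_in I"
  using ideal.subspace_diff[OF I] by (simp add: coeffs_in_def lookup_minus)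

lemma coeffs_in_sum: "(\<And>x. x \<in> A \<Longrightarrow> g x \<in> coeffs_in I) \<Longrightarrow> sum g A \<in> coeffs_in I"
  by (induction A rule: infinite_finite_induct) (simp_all add: coeffs_in_0 coeffs_in_add)

end

lemma coeffs_in_mult_gen:
  fixes P Q :: "'m::comm_monoid_add \<Rightarrow>\<^sub>0 'r::comm_ring_1"
  assumes K: "ideal.subspace K" and IJ: "\<And>a b. a \<in> I \<Longrightarrow> b \<in> J \<Longrightarrow> a * b \<in> K"
    and "P \<in> coeffs_in I" "Q \<in> coeffs_in J"
  shows "P * Q \<in> coeffs_in K"
proof (induction P rule: poly_mapping_single_induct)
  case (single m)
  show ?case
  proof (induction Q rule: poly_mapping_single_induct)
    case (single m')
    then show ?case
      using assms(3,4) by (auto simp: mult_single coeffs_in_def[of I] coeffs_in_def[of J] intro!: coeffs_in_single[OF K] IJ)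
  qed (simp_all add: coeffs_in_0[OF K] distrib_left coeffs_in_add[OF K])
qed (simp_all add: coeffs_in_0[OF K] distrib_right coeffs_in_add[OF K])

lemma coeffs_in_mult:
  fixes P Q :: "'m::comm_monoid_add \<Rightarrow>\<^sub>0 'r::comm_ring_1"
  assumes "ideal.subspace I" "Q \<in> coeffs_in I"
  shows "P * Q \<in> coeffs_in I"
  using coeffs_in_mult_gen[of I UNIV I P Q] assms ideal.subspace_scale[of I]
  by (auto simp: coeffs_in_def[of UNIV])

section \<open>Partial derivatives\<close>

text \<open>The subtraction of exponents truncates when \<open>v\<close> does not occur in
  \<open>m\<close>, but then the coefficient is 0.\<close>

definition pd :: "'v \<Rightarrow> ('v, 'r::comm_ring_1) mpoly \<Rightarrow> ('v, 'r) mpoly"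
  where "pd v = sum_terms (\<lambda>m c. Poly_Mapping.single (m - Poly_Mapping.single v 1)
    (of_nat (Poly_Mapping.lookup m v) * c))"

lemma pd_single: "pd v (Poly_Mapping.single m c) =
    Poly_Mapping.single (m - Poly_Mapping.single v 1) (of_nat (Poly_Mapping.lookup m v) * c)"
  by (simp add: pd_def sum_terms_single)

lemma pd_0 [simp]: "pd v 0 = 0"
  by (simp add: pd_def)

lemma pd_add: "pd v (P + Q) = pd v P + pd v Q"
  unfolding pd_def by (rule sum_terms_add) (simp_all add: distrib_left single_add)

lemma pd_uminus: "pd v (- P) = - pd v P"
  using pd_add[of v P "- P"] by (simp add: eq_neg_iff_add_eq_0 add.commute)

lemma pd_diff: "pd v (P - Q) = pd v P - pd v Q"
  using pd_add[of v P "- Q"] by (simp add: pd_uminus)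

lemma pd_sum: "pd v (sum g A) = (\<Sum>x\<in>A. pd v (g x))"
  by (induction A rule: infinite_finite_induct) (simp_all add: pd_add)

lemma pd_1 [simp]: "pd v 1 = 0"
  using pd_single[of v 0 1] by simp

lemma single_le_split:
  "Poly_Mapping.lookup m v \<noteq> (0::nat) \<Longrightarrow>
    \<exists>m'. m = m' + Poly_Mapping.single v 1"
  by (rule exI[of _ "m - Poly_Mapping.single v 1"], rule poly_mapping_eqI)
    (auto simp: lookup_add lookup_minus lookup_single when_def)

lemma pd_mult: "pd v (P * Q) = pd v P * Q + P * pd v Q"
proof (induction P rule: poly_mapping_single_induct)
  case (single m)
  let ?e = "Poly_Mapping.single v (1::nat)"
  show ?case
  proof (induction Q rule: poly_mapping_single_induct)
    case (single m')
    \<comment> \<open>Moving \<open>?e\<close> to one factor is valid only if \<open>v\<close>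
      occurs in that factor; otherwise the coefficient \<open>?a\<close> or \<open>?b\<close>
      vanishes.\<close>
    have 1: "m + m' - ?e = (m - ?e) + m'" if nz: "Poly_Mapping.lookup m v \<noteq> 0"
    proof -
      obtain m0 where "m = m0 + ?e" using single_le_split[OF nz] by blast
      then have "m + m' = (m0 + m') + ?e" by (simp add: add_ac)
      then show ?thesis using \<open>m = m0 + ?e\<close> by (simp only: add_diff_cancel_right')
    qed
    have 2: "m + m' - ?e = m + (m' - ?e)" if nz: "Poly_Mapping.lookup m' v \<noteq> 0"
    proof -
      obtain m0 where "m' = m0 + ?e" using single_le_split[OF nz] by blast
      then have "m + m' = (m + m0) + ?e" by (simp add: add_ac)
      then show ?thesis using \<open>m' = m0 + ?e\<close> by (simp only: add_diff_cancel_right')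
    qed
    let ?a = "of_nat (Poly_Mapping.lookup m v) * (Poly_Mapping.lookup P m * Poly_Mapping.lookup Q m')"
    let ?b = "of_nat (Poly_Mapping.lookup m' v) * (Poly_Mapping.lookup P m * Poly_Mapping.lookup Q m')"
    have "Poly_Mapping.single (m + m' - ?e) ?a = Poly_Mapping.single ((m - ?e) + m') ?a"
      by (cases "Poly_Mapping.lookup m v = 0") (simp_all only: 1 not_False_eq_True of_nat_0 mult_zero_left single_zero)
    moreover have "Poly_Mapping.single (m + m' - ?e) ?b = Poly_Mapping.single (m + (m' - ?e)) ?b"
      by (cases "Poly_Mapping.lookup m' v = 0") (simp_all only: 2 not_False_eq_True of_nat_0 mult_zero_left single_zero)
    ultimately have "Poly_Mapping.single (m + m' - ?e) (?a + ?b) =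
        Poly_Mapping.single ((m - ?e) + m') ?a + Poly_Mapping.single (m + (m' - ?e)) ?b"
      by (simp only: single_add)
    then show ?case
      by (simp only: mult_single pd_single lookup_add of_nat_add distrib_right mult.assoc
          mult.left_commute[of "Poly_Mapping.lookup P m"])
  qed (simp_all add: pd_add distrib_left)
qed (simp_all add: pd_add distrib_right)

lemma pd_comm: "pd u (pd v P) = pd v (pd u P)"
proof (induction P rule: poly_mapping_single_induct)
  case (single m)
  have *: "m - Poly_Mapping.single u 1 - Poly_Mapping.single v 1 =
        m - Poly_Mapping.single v 1 - Poly_Mapping.single u (1::nat)"
    by (rule poly_mapping_eqI) (simp add: lookup_minus)
  have **: "Poly_Mapping.lookup (m - Poly_Mapping.single v 1) u = Poly_Mapping.lookup m u"
    "Poly_Mapping.lookup (m - Poly_Mapping.single u 1) v = Poly_Mapping.lookup m v" if "u \<noteq> v"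
    using that by (simp_all add: lookup_minus lookup_single)
  show ?case
  proof (cases "u = v")
    case False
    show ?thesis
      unfolding pd_single * **[OF False] by (simp only: mult.left_commute)
  qed simp
qed (simp_all add: pd_add)

lemma pd_prod:
  "finite A \<Longrightarrow> pd v (prod g A) = (\<Sum>x\<in>A. pd v (g x) * prod g (A - {x}))"
proof (induction A rule: finite_induct)
  case (insert a A)
  have "prod g (insert a A - {x}) = g a * prod g (A - {x})" if "x \<in> A" for x
  proof -
    have "insert a A - {x} = insert a (A - {x})"
      using that insert by auto
    then show ?thesis
      using insert by simp
  qed
  moreover have "insert a A - {a} = A"
    using insert by auto
  ultimately show ?case
    using insert by (simp add: pd_mult sum_distrib_left mult_ac)
qed simp

lemma deg_le_pd:
  assumes "deg_le d P" shows "deg_le d (pd v P)"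
proof (induction P rule: poly_mapping_single_induct)
  case (single m)
  have "total (m - Poly_Mapping.single v 1) \<le> total m"
    unfolding total_def by (rule sum_mono) (simp add: lookup_minus)
  then show ?case
    using assms single by (force simp: deg_le_def pd_single)
qed (simp_all add: pd_add deg_le_add)

lemma coeffs_in_pd:
  assumes I: "ideal.subspace I" and P: "P \<in> coeffs_in I"
  shows "pd v P \<in> coeffs_in I"
proof (induction P rule: poly_mapping_single_induct)
  case (single m)
  then show ?case
    using P ideal.subspace_scale[OF I]
    by (auto simp: pd_single coeffs_in_def[of I] lookup_single when_def ideal.subspace_0[OF I])
qed (simp_all add: pd_add coeffs_in_0[OF I] coeffs_in_add[OF I])

definition mvar :: "'v \<Rightarrow> ('v, 'r::comm_ring_1) mpoly"
  where "mvar v = Poly_Mapping.single (Poly_Mapping.single v 1) 1"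

lemma pd_mvar: "pd u (mvar v) = (if u = v then 1 else 0)"
  by (auto simp: mvar_def pd_single lookup_single when_def)

section \<open>Jacobian determinants\<close>

text \<open>Composition with a transposition pairs even with odd permutations, and paired terms
  cancel.\<close>

lemma alternating_sum_eq_0:
  fixes t :: "('v::finite \<Rightarrow> 'v) \<Rightarrow> 'b::comm_ring_1"
  assumes "a \<noteq> b" and inv: "\<And>\<sigma>. t (\<sigma> \<circ> Transposition.transpose a b) = t \<sigma>"
  shows "(\<Sum>\<sigma> | \<sigma> permutes UNIV. of_int (sign \<sigma>) * t \<sigma>) = 0"
proof -
  let ?\<tau> = "Transposition.transpose a b"
  let ?E = "{\<sigma>. \<sigma> permutes (UNIV :: 'v set) \<and> evenperm \<sigma>}"
  let ?O = "{\<sigma>. \<sigma> permutes (UNIV :: 'v set) \<and> \<not> evenperm \<sigma>}"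
  have ev: "evenperm (\<sigma> \<circ> ?\<tau>) \<longleftrightarrow> \<not> evenperm \<sigma>" if "\<sigma> permutes UNIV" for \<sigma>
    using that assms(1) permutation_permutes[of \<sigma>]
    by (subst evenperm_comp) (auto simp: permutation_swap_id evenperm_swap)
  have pm: "(\<sigma> \<circ> ?\<tau>) permutes UNIV" if "\<sigma> permutes UNIV" for \<sigma>
    using that by (intro permutes_compose permutes_swap_id) auto
  have idem: "\<sigma> \<circ> ?\<tau> \<circ> ?\<tau> = \<sigma>" for \<sigma> :: "'v \<Rightarrow> 'v"
    by (simp add: fun_eq_iff)
  have "sum t ?O = sum t ?E"
    by (rule sum.reindex_bij_witness[where i="\<lambda>\<sigma>. \<sigma> \<circ> ?\<tau>" and j="\<lambda>\<sigma>. \<sigma> \<circ> ?\<tau>"])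
      (use ev pm idem inv in auto)
  moreover have "(\<Sum>\<sigma> | \<sigma> permutes UNIV. of_int (sign \<sigma>) * t \<sigma>) = sum t ?E - sum t ?O"
  proof -
    have "{\<sigma>. \<sigma> permutes (UNIV :: 'v set)} = ?E \<union> ?O" by auto
    moreover have "sum (\<lambda>\<sigma>. of_int (sign \<sigma>) * t \<sigma>) (?E \<union> ?O) =
        (\<Sum>\<sigma>\<in>?E. of_int (sign \<sigma>) * t \<sigma>) + (\<Sum>\<sigma>\<in>?O. of_int (sign \<sigma>) * t \<sigma>)"
      by (rule sum.union_disjoint) auto
    moreover have "(\<Sum>\<sigma>\<in>?E. of_int (sign \<sigma>) * t \<sigma>) = sum t ?E"
      by (rule sum.cong) (auto simp: sign_def)
    moreover have "(\<Sum>\<sigma>\<in>?O. of_int (sign \<sigma>) * t \<sigma>) = - sum t ?O"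
      unfolding sum_negf[symmetric] by (rule sum.cong) (auto simp: sign_def)
    ultimately show ?thesis by simp
  qed
  ultimately show ?thesis by simp
qed

definition jacobian :: "('v::finite \<Rightarrow> ('v, 'r::comm_ring_1) mpoly) \<Rightarrow> ('v, 'r) mpoly ^ 'v ^ 'v"
  where "jacobian \<phi> = (\<chi> i j. pd j (\<phi> i))"

lemma det_jacobian_def:
  "det (jacobian \<phi>) = (\<Sum>\<sigma> | \<sigma> permutes UNIV. of_int (sign \<sigma>) * (\<Prod>i\<in>UNIV. pd (\<sigma> i) (\<phi> i)))"
  by (simp add: det_def jacobian_def)

text \<open>The cofactors of row \<open>k\<close> of a Jacobian matrix form a divergence-free
  vector. Second derivatives commute, so exchanging the values of \<open>\<sigma>\<close> at
  \<open>k\<close> and \<open>l\<close> fixes a term and reverses its sign factor.\<close>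

lemma piola:
  fixes \<phi> :: "'v::finite \<Rightarrow> ('v, 'r::comm_ring_1) mpoly"
  shows "(\<Sum>\<sigma> | \<sigma> permutes UNIV. of_int (sign \<sigma>) *
    pd (\<sigma> k) (\<Prod>i\<in>UNIV - {k}. pd (\<sigma> i) (\<phi> i))) = 0"
proof -
  \<comment> \<open>The summand of the product rule in which the factor with index \<open>l\<close>
    is differentiated.\<close>
  define t where "t l \<sigma> = pd (\<sigma> k) (pd (\<sigma> l) (\<phi> l)) * (\<Prod>i\<in>UNIV - {k} - {l}. pd (\<sigma> i) (\<phi> i))"
    for l \<sigma>
  have "(\<Sum>\<sigma> | \<sigma> permutes UNIV. of_int (sign \<sigma>) * t l \<sigma>) = 0" if "l \<in> UNIV - {k}" for l
  proof (rule alternating_sum_eq_0)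
    show "k \<noteq> l" using that by auto
    show "t l (\<sigma> \<circ> Transposition.transpose k l) = t l \<sigma>" for \<sigma>
      unfolding t_def by (intro arg_cong2[where f="(*)"] prod.cong)
        (auto simp: pd_comm transpose_def)
  qed
  then have "(\<Sum>l\<in>UNIV - {k}. \<Sum>\<sigma> | \<sigma> permutes UNIV. of_int (sign \<sigma>) * t l \<sigma>) = 0"
    by simp
  then show ?thesis
    by (subst (asm) sum.swap) (simp add: pd_prod t_def sum_distrib_left)
qed

text \<open>Expansion along row \<open>k\<close> with the derivative pulled in front of the product;
  the additional terms of the product rule vanish by \<open>piola\<close>.\<close>

lemma det_jacobian_divergence:
  fixes \<phi> :: "'v::finite \<Rightarrow> ('v, 'r::comm_ring_1) mpoly"
  shows "det (jacobian \<phi>) = (\<Sum>\<sigma> | \<sigma> permutes UNIV. of_int (sign \<sigma>) *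
    pd (\<sigma> k) (\<phi> k * (\<Prod>i\<in>UNIV - {k}. pd (\<sigma> i) (\<phi> i))))"
proof -
  let ?P = "\<lambda>\<sigma>. \<Prod>i\<in>UNIV - {k}. pd (\<sigma> i) (\<phi> i)"
  have "(\<Sum>\<sigma> | \<sigma> permutes UNIV. of_int (sign \<sigma>) * pd (\<sigma> k) (\<phi> k * ?P \<sigma>)) =
    (\<Sum>\<sigma> | \<sigma> permutes UNIV. of_int (sign \<sigma>) * (pd (\<sigma> k) (\<phi> k) * ?P \<sigma>)) +
    \<phi> k * (\<Sum>\<sigma> | \<sigma> permutes UNIV. of_int (sign \<sigma>) * pd (\<sigma> k) (?P \<sigma>))"
    by (simp add: pd_mult distrib_left sum.distrib sum_distrib_left mult.left_commute)
  also have "\<dots> = det (jacobian \<phi>)"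
    unfolding piola det_jacobian_def by (simp add: prod.remove[of UNIV k])
  finally show ?thesis by simp
qed

lemma coeffs_in_det:
  fixes A :: "('v, 'r::comm_ring_1) mpoly ^ 'n ^ 'n"
  assumes I: "ideal.subspace I" and A: "\<And>j. A $ k $ j \<in> coeffs_in I"
  shows "det A \<in> coeffs_in I"
  unfolding det_def
proof (intro coeffs_in_sum[OF I] coeffs_in_mult[OF I])
  fix \<sigma> :: "'n \<Rightarrow> 'n"
  have "(\<Prod>i\<in>UNIV. A $ i $ \<sigma> i) = (\<Prod>i\<in>UNIV - {k}. A $ i $ \<sigma> i) * A $ k $ \<sigma> k"
    by (simp add: prod.remove[of UNIV k] mult.commute)
  then show "(\<Prod>i\<in>UNIV. A $ i $ \<sigma> i) \<in> coeffs_in I"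
    using coeffs_in_mult[OF I A] by simp
qed

text \<open>Cramer's rule: by linearity in row \<open>k\<close>, all summands with
  \<open>l \<noteq> k\<close> have a repeated row.\<close>

lemma det_replace_row:
  fixes A :: "'b::comm_ring_1 ^ 'n ^ 'n"
  shows "det (\<chi> i. if i = k then (\<Sum>l\<in>UNIV. c l *s A $ l) else A $ i) = c k * det A"
proof -
  have *: "det (\<chi> i. if i = k then A $ l else A $ i) = (if l = k then det A else 0)" for l
  proof (cases "l = k")
    case True
    have "(\<chi> i. if i = k then A $ l else A $ i) = A"
      by (simp add: vec_eq_iff True)
    then show ?thesis using True by simp
  next
    case False
    then have "det (\<chi> i. if i = k then A $ l else A $ i) = 0"
      by (intro det_identical_rows[of l k]) (auto simp: row_def)
    then show ?thesis using False by simp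
  qed
  show ?thesis
    unfolding det_linear_row_sum[OF finite] det_row_mul * by (simp add: if_distrib cong: if_cong)
qed

lemma det_jacobian_add:
  fixes \<phi> :: "'v::finite \<Rightarrow> ('v, 'r::comm_ring_1) mpoly"
  shows "det (jacobian (\<phi>(k := p + q))) = det (jacobian (\<phi>(k := p))) + det (jacobian (\<phi>(k := q)))"
proof -
  have "jacobian (\<phi>(k := r)) = (\<chi> i. if i = k then (\<chi> j. pd j r) else (\<chi> j. pd j (\<phi> i)))" for r
    by (simp add: jacobian_def vec_eq_iff)
  moreover have "(\<chi> j. pd j (p + q)) = (\<chi> j. pd j p) + (\<chi> j. pd j q)"
    by (simp add: vec_eq_iff pd_add)
  ultimately show ?thesis
    by (simp only: det_row_add)
qed

lemma det_jacobian_mvar: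
  "det (jacobian mvar) = (1 :: ('v::finite, 'r::comm_ring_1) mpoly)"
proof -
  have "jacobian mvar = (mat 1 :: ('v::finite, 'r::comm_ring_1) mpoly ^ 'v ^ 'v)"
    by (simp add: jacobian_def mat_def vec_eq_iff pd_mvar)
  then show ?thesis by simp
qed

text \<open>Differentiating the relation gives a linear combination of the rows equal to the
  gradient of \<open>w\<close>, so Cramer's rule puts each \<open>h i * det ?A\<close> into the
  extended ideal. The relation turns these into \<open>(1 + w) * det ?A\<close>, and
  \<open>w * det ?A\<close> lies there anyway.\<close>

lemma det_jacobian_relation:
  fixes h u :: "'n::finite \<Rightarrow> ('n + 'n, 'r::comm_ring_1) mpoly"
  assumes I: "ideal.subspace I" and w: "w \<in> coeffs_in I"
    and rel: "(\<Sum>i\<in>UNIV. h i * u i) = 1 + w"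
  shows "det (jacobian (case_sum h u)) \<in> coeffs_in I"
proof -
  let ?A = "jacobian (case_sum h u)"
  let ?c = "case_sum u h"
  have sum_UNIV: "(\<Sum>l\<in>UNIV. F l) = (\<Sum>i\<in>UNIV. F (Inl i)) + (\<Sum>i\<in>UNIV. F (Inr i))"
    for F :: "'n + 'n \<Rightarrow> ('n + 'n, 'r) mpoly"
    using sum.Plus[of UNIV UNIV F] by simp
  have row: "(\<Sum>l\<in>UNIV. ?c l *s ?A $ l) = (\<chi> j. pd j w)"
  proof -
    have "(\<Sum>l\<in>UNIV. ?c l * pd j (case_sum h u l)) = pd j (1 + w)" for j
      unfolding rel[symmetric] pd_sum sum_UNIV by (simp add: pd_mult sum.distrib mult.commute)
    then show ?thesis
      by (simp add: vec_eq_iff jacobian_def pd_add)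
  qed
  \<comment> \<open>The row of \<open>u i\<close> has the coefficient \<open>h i\<close> in the
    combination.\<close>
  have "?c (Inr i) * det ?A \<in> coeffs_in I" for i
    unfolding det_replace_row[symmetric] row
    by (rule coeffs_in_det[OF I, of _ "Inr i"]) (simp add: coeffs_in_pd[OF I w])
  then have "h i * det ?A \<in> coeffs_in I" for i
    by simp
  then have "(\<Sum>i\<in>UNIV. u i * (h i * det ?A)) \<in> coeffs_in I"
    by (rule coeffs_in_sum[OF I coeffs_in_mult[OF I]])
  also have "(\<Sum>i\<in>UNIV. u i * (h i * det ?A)) = (1 + w) * det ?A"
    unfolding rel[symmetric] sum_distrib_right by (simp add: mult_ac)
  finally have "(1 + w) * det ?A - det ?A * w \<in> coeffs_in I"
    by (rule coeffs_in_diff[OF I _ coeffs_in_mult[OF I w]])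
  then show ?thesis
    by (simp add: algebra_simps)
qed

section \<open>The moment functional of the quadric\<close>

definition balanced :: "('n + 'n \<Rightarrow>\<^sub>0 nat) \<Rightarrow> bool"
  where "balanced m \<longleftrightarrow> (\<forall>i. Poly_Mapping.lookup m (Inl i) = Poly_Mapping.lookup m (Inr i))"

definition weight :: "(('n \<Rightarrow> nat) \<Rightarrow> int) \<Rightarrow> ('n + 'n \<Rightarrow>\<^sub>0 nat) \<Rightarrow> int"
  where "weight c m = (if balanced m then c (\<lambda>i. Poly_Mapping.lookup m (Inl i)) else 0)"

definition moment :: "(('n \<Rightarrow> nat) \<Rightarrow> int) \<Rightarrow> ('n, 'r::comm_ring_1) two_family_poly \<Rightarrow> 'r"
  where "moment c = sum_terms (\<lambda>m a. of_int (weight c m) * a)"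

lemma moment_single: "moment c (Poly_Mapping.single m a) = of_int (weight c m) * a"
  by (simp add: moment_def sum_terms_single)

lemma moment_0 [simp]: "moment c 0 = 0"
  by (simp add: moment_def)

lemma moment_add: "moment c (P + Q) = moment c P + moment c Q"
  unfolding moment_def by (rule sum_terms_add) (simp_all add: distrib_left)

lemma moment_uminus: "moment c (- P) = - moment c P"
  using moment_add[of c P "- P"] by (simp add: eq_neg_iff_add_eq_0 add.commute)

lemma moment_diff: "moment c (P - Q) = moment c P - moment c Q"
  using moment_add[of c P "- Q"] by (simp add: moment_uminus)

lemma moment_sum: "moment c (sum g A) = (\<Sum>x\<in>A. moment c (g x))"
  by (induction A rule: infinite_finite_induct) (simp_all add: moment_add)

lemma moment_1: "moment c 1 = of_int (c (\<lambda>_. 0))"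
  using moment_single[of c 0 1] by (simp add: weight_def balanced_def)

lemma moment_in:
  assumes I: "ideal.subspace I" and P: "P \<in> coeffs_in I"
  shows "moment c P \<in> I"
proof (induction P rule: poly_mapping_single_induct)
  case (single m)
  then show ?case
    using P ideal.subspace_scale[OF I] by (simp add: moment_single coeffs_in_def)
qed (simp_all add: moment_add ideal.subspace_0[OF I] ideal.subspace_add[OF I])

definition quadric :: "('n::finite, 'r::comm_ring_1) two_family_poly"
  where "quadric = (\<Sum>i\<in>UNIV. X i * Y i) - 1"

definition XY_exp :: "'n \<Rightarrow> ('n + 'n \<Rightarrow>\<^sub>0 nat)"
  where "XY_exp l = Poly_Mapping.single (Inl l) 1 + Poly_Mapping.single (Inr l) 1"

lemma lookup_XY_exp: "Poly_Mapping.lookup (XY_exp l) j = (if j = Inl l \<or> j = Inr l then 1 else 0)"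
  by (auto simp: XY_exp_def lookup_add lookup_single when_def)

lemma quadric_mult_single:
  "quadric * Poly_Mapping.single m a =
    (\<Sum>l\<in>UNIV. Poly_Mapping.single (m + XY_exp l) a) - Poly_Mapping.single m a"
proof -
  have "X l * Y l * Poly_Mapping.single m a = Poly_Mapping.single (m + XY_exp l) a" for l
    by (simp add: X_def Y_def XY_exp_def mult_single add.commute)
  then show ?thesis
    by (simp add: quadric_def left_diff_distrib sum_distrib_right)
qed

text \<open>The recursion satisfied by \<open>b! / (n + |b|)!\<close> and its multiples. It is
  imposed only up to \<open>d\<close>, so that finitely many denominators have to be
  cleared.\<close>

definition moment_weights :: "nat \<Rightarrow> (('n::finite \<Rightarrow> nat) \<Rightarrow> int) \<Rightarrow> bool"
  where "moment_weights d c \<longleftrightarrow> (\<forall>b i. sum b UNIV < d \<longrightarrow>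
    int (CARD('n) + sum b UNIV + 1) * c (b(i := Suc (b i))) = int (b i + 1) * c b)"

text \<open>This says for a single monomial \<open>m\<close> that the moment kills the derivative of
  \<open>quadric\<close> times \<open>m\<close>. Summing the recursion over \<open>l\<close> yields
  the factor \<open>n + s + 1\<close>, with the 1 contributed by \<open>l = i\<close>, and this
  factor cancels.\<close>

lemma weight_identity:
  fixes c :: "('n::finite \<Rightarrow> nat) \<Rightarrow> int" and j :: "'n + 'n"
  assumes c: "moment_weights d c" and m: "total m \<le> 2 * d"
  defines "e \<equiv> Poly_Mapping.single j (1::nat)"
  shows "(\<Sum>l\<in>UNIV. weight c (m + XY_exp l - e) * int (Poly_Mapping.lookup (m + XY_exp l) j))
    = weight c (m - e) * int (Poly_Mapping.lookup m j)"
proof -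
  \<comment> \<open>The index of the pair \<open>X i\<close>, \<open>Y i\<close> to which the
    variable \<open>j\<close> belongs.\<close>
  define i where "i = case_sum id id j"
  have j: "j = Inl i \<or> j = Inr i"
    by (cases j) (auto simp: i_def)
  have XYj: "Poly_Mapping.lookup (XY_exp l) j = (if l = i then 1 else 0)" for l
    using j by (auto simp: lookup_XY_exp)
  show ?thesis
  proof (cases "Poly_Mapping.lookup m j = 0")
    \<comment> \<open>For \<open>l \<noteq> i\<close> the exponent factor is 0. For
      \<open>l = i\<close> the exponent at \<open>j\<close> returns to 0 while that of its partner
      is positive, so the monomial is unbalanced.\<close>
    case True
    have "weight c (m + XY_exp l - e) * int (Poly_Mapping.lookup (m + XY_exp l) j) = 0" for l
    proof (cases "l = i")
      case False
      then have "Poly_Mapping.lookup (m + XY_exp l) j = 0"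
        using True XYj[of l] by (simp add: lookup_add[of m])
      then show ?thesis by simp
    next
      case l: True
      have "\<not> balanced (m + XY_exp l - e)"
        unfolding balanced_def not_all
        using j True l
        by (intro exI[of _ i]) (auto simp: e_def lookup_add lookup_minus lookup_single lookup_XY_exp)
      then show ?thesis by (simp add: weight_def)
    qed
    then show ?thesis using True by (simp only: sum.neutral_const of_nat_0 mult_zero_right)
  next
    case False
    then obtain m0 where m0: "m = m0 + e"
      using single_le_split[OF False] unfolding e_def by blast
    have m_e: "m - e = m0"
      unfolding m0 by (rule add_diff_cancel_right')
    have mXY: "m + XY_exp l - e = m0 + XY_exp l" for l
    proof -
      have "m + XY_exp l = (m0 + XY_exp l) + e"
        unfolding m0 by (simp only: add_ac)
      then show ?thesis by (simp only: add_diff_cancel_right')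
    qed
    have lm: "Poly_Mapping.lookup m j = Poly_Mapping.lookup m0 j + 1"
      unfolding m0 by (simp add: e_def lookup_add)
    have lXY: "Poly_Mapping.lookup (m + XY_exp l) j =
        Poly_Mapping.lookup m0 j + 1 + (if l = i then 1 else 0)" for l
      using lm XYj[of l] by (simp add: lookup_add[of m])
    have bal: "balanced (m0 + XY_exp l) \<longleftrightarrow> balanced m0" for l
      by (auto simp: balanced_def lookup_add lookup_XY_exp)
    show ?thesis
    proof (cases "balanced m0")
      case False
      then show ?thesis
        unfolding m_e mXY by (simp add: weight_def bal)
    next
      case True
      define b where "b = (\<lambda>i. Poly_Mapping.lookup m0 (Inl i))"
      have w: "weight c (m0 + XY_exp l) = c (b(l := Suc (b l)))" for l
      proof -
        have "(\<lambda>i. Poly_Mapping.lookup (m0 + XY_exp l) (Inl i)) = b(l := Suc (b l))"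
          by (auto simp: fun_eq_iff b_def lookup_add lookup_XY_exp)
        then show ?thesis using True by (simp add: weight_def bal)
      qed
      have w0: "weight c m0 = c b"
        using True by (simp add: weight_def b_def)
      have bj: "Poly_Mapping.lookup m0 j = b i"
        using j True by (auto simp: b_def balanced_def)
      define s where "s = sum b UNIV"
      have "total m0 = (\<Sum>i\<in>UNIV. Poly_Mapping.lookup m0 (Inl i)) + (\<Sum>i\<in>UNIV. Poly_Mapping.lookup m0 (Inr i))"
        unfolding total_def using sum.Plus[of UNIV UNIV "Poly_Mapping.lookup m0"] by simp
      also have "\<dots> = 2 * s"
        using True by (simp add: b_def s_def balanced_def)
      \<comment> \<open>Removing \<open>e\<close> leaves \<open>2 * s < total m\<close>, and
        \<open>total m \<le> 2 * d\<close>.\<close>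
      finally have "s < d"
        using m by (simp add: m0 total_add e_def)
      then have cr: "int (CARD('n) + s + 1) * c (b(l := Suc (b l))) = int (b l + 1) * c b" for l
        using c by (simp add: moment_weights_def s_def)
      have "int (CARD('n) + s + 1) *
          (\<Sum>l\<in>UNIV. c (b(l := Suc (b l))) * int (b i + 1 + (if l = i then 1 else 0))) =
        (\<Sum>l\<in>UNIV. int (b l + 1) * c b * int (b i + 1 + (if l = i then 1 else 0)))"
        unfolding sum_distrib_left mult.assoc[symmetric] cr ..
      also have "\<dots> = (\<Sum>l\<in>UNIV. c b * int (b i + 1) * int (b l + 1) +
          (if l = i then c b * int (b i + 1) else 0))"
        by (rule sum.cong) (auto simp: algebra_simps)
      also have "\<dots> = c b * int (b i + 1) * (\<Sum>l\<in>UNIV. int (b l + 1)) + c b * int (b i + 1)"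
        unfolding sum.distrib sum_distrib_left by simp
      also have "(\<Sum>l\<in>UNIV. int (b l + 1)) = int (CARD('n) + s)"
        by (simp add: sum.distrib s_def)
      also have "c b * int (b i + 1) * int (CARD('n) + s) + c b * int (b i + 1) =
          int (CARD('n) + s + 1) * (c b * int (b i + 1))"
        by (simp add: algebra_simps)
      finally have "int (CARD('n) + s + 1) *
          (\<Sum>l\<in>UNIV. c (b(l := Suc (b l))) * int (b i + 1 + (if l = i then 1 else 0))) =
        int (CARD('n) + s + 1) * (c b * int (b i + 1))" .
      then have "(\<Sum>l\<in>UNIV. c (b(l := Suc (b l))) * int (b i + 1 + (if l = i then 1 else 0))) =
        c b * int (b i + 1)"
        by (subst (asm) mult_left_cancel) auto
      then show ?thesis
        unfolding m_e mXY lXY w w0 lm bj .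
    qed
  qed
qed

text \<open>In the integral picture this is the divergence theorem: \<open>quadric\<close> vanishes
  on the boundary sphere of the ball. By linearity it reduces to monomials.\<close>

lemma moment_pd_quadric_mult:
  fixes P :: "('n::finite, 'r::comm_ring_1) two_family_poly"
  assumes c: "moment_weights d c" and P: "deg_le (2 * d) P"
  shows "moment c (pd j (quadric * P)) = 0"
proof (induction P rule: poly_mapping_single_induct)
  case (single m)
  let ?a = "Poly_Mapping.lookup P m" and ?e = "Poly_Mapping.single j (1::nat)"
  have "total m \<le> 2 * d"
    using P single by (simp add: deg_le_def)
  from weight_identity[OF c this, of j, THEN arg_cong, of "of_int :: int \<Rightarrow> 'r"]
  have "(\<Sum>l\<in>UNIV. of_int (weight c (m + XY_exp l - ?e)) * of_nat (Poly_Mapping.lookup (m + XY_exp l) j))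
    = (of_int (weight c (m - ?e)) * of_nat (Poly_Mapping.lookup m j) :: 'r)"
    by simp
  then have "(\<Sum>l\<in>UNIV. of_int (weight c (m + XY_exp l - ?e)) *
      (of_nat (Poly_Mapping.lookup (m + XY_exp l) j) * ?a))
    = of_int (weight c (m - ?e)) * (of_nat (Poly_Mapping.lookup m j) * ?a)"
    by (simp only: mult.assoc[symmetric] flip: sum_distrib_right)
  then show ?case
    by (simp only: quadric_mult_single pd_diff pd_sum pd_single moment_diff moment_sum moment_single
        diff_self)
qed (simp_all add: distrib_left pd_add moment_add)

text \<open>Expanded along row \<open>k\<close>, the determinant is a sum of derivatives of
  multiples of \<open>quadric\<close>. The cofactor of \<open>quadric\<close> has degree at most
  \<open>2 * n * e\<close>: one \<open>e\<close> for \<open>g\<close> and one for each of the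
  \<open>2 * n - 1\<close> derivatives.\<close>

lemma moment_det_jacobian_multiple:
  fixes \<phi> :: "'n::finite + 'n \<Rightarrow> ('n, 'r::comm_ring_1) two_family_poly"
  assumes c: "moment_weights d c" and k: "\<phi> k = quadric * g"
    and g: "deg_le e g" and \<phi>: "\<And>i. deg_le e (\<phi> i)" and d: "CARD('n) * e \<le> d"
  shows "moment c (det (jacobian \<phi>)) = 0"
proof -
  let ?P = "\<lambda>\<sigma>. \<Prod>i\<in>UNIV - {k}. pd (\<sigma> i) (\<phi> i)"
  have "moment c (of_int (sign \<sigma>) * pd (\<sigma> k) (\<phi> k * ?P \<sigma>)) = 0" for \<sigma> :: "'n + 'n \<Rightarrow> 'n + 'n"
  proof -
    have "deg_le (e + card (UNIV - {k}) * e) (g * ?P \<sigma>)"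
      by (intro deg_le_mult deg_le_prod deg_le_pd g \<phi>)
    then have "deg_le (2 * d) (g * ?P \<sigma>)"
    proof (rule deg_le_mono)
      have "e + card (UNIV - {k}) * e = CARD('n + 'n) * e"
        by (simp add: card_Diff_singleton flip: mult_Suc)
      then show "e + card (UNIV - {k}) * e \<le> 2 * d"
        using d by (simp add: card_UNIV_sum distrib_right)
    qed
    from moment_pd_quadric_mult[OF c this]
    have "moment c (pd (\<sigma> k) (\<phi> k * ?P \<sigma>)) = 0"
      by (simp add: k mult.assoc)
    then show ?thesis
      by (simp add: sign_def moment_uminus)
  qed
  then show ?thesis
    unfolding det_jacobian_divergence[of \<phi> k] moment_sum by simp
qed

text \<open>Starting from the identity map, the components are exchanged one at a time. Each
  exchange adds a Jacobian determinant with one component a multiple of \<open>quadric\<close>,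
  whose moment is 0.\<close>

lemma moment_det_jacobian_retraction:
  fixes g :: "'n::finite + 'n \<Rightarrow> ('n, 'r::comm_ring_1) two_family_poly"
  assumes c: "moment_weights d c" and d: "CARD('n) * e \<le> d"
    and g: "\<And>i. deg_le e (g i)" "\<And>i. deg_le e (mvar i + quadric * g i)" and e: "1 \<le> e"
  shows "moment c (det (jacobian (\<lambda>i. mvar i + quadric * g i))) = of_int (c (\<lambda>_. 0))"
proof -
  define \<phi> where "\<phi> S i = (if i \<in> S then mvar i + quadric * g i else mvar i)" for S i
  have mv: "deg_le e (mvar i :: ('n, 'r) two_family_poly)" for i
    unfolding mvar_def using e by (intro deg_le_single) simp
  have \<phi>e: "deg_le e (\<phi> S i)" for S i
    using g(2) mv by (simp add: \<phi>_def)
  have qg: "deg_le e (quadric * g i)" for i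
    using deg_le_diff[OF g(2)[of i] mv[of i]] by simp
  have "moment c (det (jacobian (\<phi> S))) = of_int (c (\<lambda>_. 0))" for S
    using finite[of S]
  proof (induction S rule: finite_induct)
    case empty
    have "\<phi> {} = mvar" by (simp add: \<phi>_def fun_eq_iff)
    then show ?case by (simp add: det_jacobian_mvar moment_1)
  next
    case (insert k S)
    have 1: "\<phi> (insert k S) = (\<phi> S)(k := mvar k + quadric * g k)"
      and 2: "(\<phi> S)(k := mvar k) = \<phi> S"
      using insert by (auto simp: \<phi>_def fun_eq_iff)
    have "moment c (det (jacobian ((\<phi> S)(k := quadric * g k)))) = 0"
      by (rule moment_det_jacobian_multiple[OF c _ g(1) _ d, of _ k k]) (use \<phi>e qg in auto)
    then show ?case
      using insert.IH unfolding 1 det_jacobian_add 2 moment_add by simp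
  qed
  moreover have "\<phi> UNIV = (\<lambda>i. mvar i + quadric * g i)"
    by (simp add: \<phi>_def fun_eq_iff)
  ultimately show ?thesis
    by metis
qed

section \<open>Filtrations detecting powers of the characteristic\<close>

text \<open>Such a \<open>J n\<close> contains the \<open>n\<close>-th power of the kernel of
  \<open>\<pi>\<close>. The constant kernel will serve in characteristic 0 and
  \<open>frob_ideal\<close> in characteristic \<open>p\<close>.\<close>

definition ideal_filtration :: "('r::comm_ring_1 \<Rightarrow> 'k::comm_ring_1) \<Rightarrow> (nat \<Rightarrow> 'r set) \<Rightarrow> bool"
  where "ideal_filtration \<pi> J \<longleftrightarrow>
    (\<forall>n. ideal.subspace (J n)) \<and> J 0 = UNIV \<and> {x. \<pi> x = 0} \<subseteq> J 1 \<and>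
    (\<forall>n. \<forall>x\<in>J 1. \<forall>y\<in>J n. x * y \<in> J (Suc n))"

text \<open>The middle binomial coefficients are divisible by \<open>p\<close>. A factor
  \<open>x\<close> is split off so that \<open>x * q\<close> lies in every ideal containing
  \<open>x\<close>.\<close>

lemma binomial_prime_power:
  fixes x y :: "'a::comm_ring_1"
  assumes p: "prime p"
  obtains q where "(x + y) ^ p = x ^ p + y ^ p + of_nat p * (x * q)"
proof -
  have p0: "0 < p" using p by (simp add: prime_gt_0_nat)
  have term_eq: "\<exists>q. of_nat (p choose k) * x ^ k * y ^ (p - k) = of_nat p * (x * q)"
    if k: "k \<in> {1..<p}" for k
  proof -
    have "p dvd (p choose k)"
      by (rule dvd_choose_prime) (use k p in auto)
    then obtain a where "p choose k = p * a" by (auto elim: dvdE)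
    moreover obtain k' where "k = Suc k'" using k by (cases k) auto
    ultimately show ?thesis
      by (intro exI[of _ "of_nat a * x ^ k' * y ^ (p - k)"]) (simp add: mult_ac)
  qed
  then obtain Q where Q: "\<And>k. k \<in> {1..<p} \<Longrightarrow>
      of_nat (p choose k) * x ^ k * y ^ (p - k) = of_nat p * (x * Q k)"
    by metis
  have "{..p} = insert 0 (insert p {1..<p})"
    using p0 by auto
  then have "(x + y) ^ p = y ^ p + (x ^ p + (\<Sum>k\<in>{1..<p}. of_nat (p choose k) * x ^ k * y ^ (p - k)))"
    unfolding binomial_ring using p0 by simp
  also have "(\<Sum>k\<in>{1..<p}. of_nat (p choose k) * x ^ k * y ^ (p - k)) = of_nat p * (x * sum Q {1..<p})"
    by (simp add: Q sum_distrib_left)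
  finally show thesis
    by (intro that[of "sum Q {1..<p}"]) (simp add: add_ac)
qed

locale frobenius_lift =
  fixes \<pi> :: "'r::comm_ring_1 \<Rightarrow> 'k::comm_ring_1" and F :: "'r \<Rightarrow> 'r" and p :: nat
  assumes p: "prime p"
    and \<pi>_add: "\<pi> (x + y) = \<pi> x + \<pi> y" and \<pi>_mult: "\<pi> (x * y) = \<pi> x * \<pi> y"
    and \<pi>_p: "\<pi> (of_nat p) = 0"
    and F_add: "F (x + y) = F x + F y" and F_mult: "F (x * y) = F x * F y"
    and F_frobenius: "\<exists>y. F x = x ^ p + of_nat p * y"
begin

text \<open>
  With \<open>\<delta> x = (F x - x ^ p) / p\<close>, the set \<open>frob_ideal n\<close> consists of the \<open>x\<close> for which
  \<open>x, \<delta> x, \<dots>, \<delta>\<^sup>n\<^sup>-\<^sup>1 x\<close> all lie in the kernel of \<open>\<pi>\<close>.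
\<close>

primrec frob_ideal :: "nat \<Rightarrow> 'r set"
  where "frob_ideal 0 = UNIV"
  | "frob_ideal (Suc n) = {x. \<pi> x = 0 \<and> (\<exists>y\<in>frob_ideal n. F x = x ^ p + of_nat p * y)}"

lemma p_gt_0: "0 < p"
  using p by (simp add: prime_gt_0_nat)

lemma \<pi>_0: "\<pi> 0 = 0"
  using \<pi>_add[of 0 0] by simp

lemma F_0: "F 0 = 0"
  using F_add[of 0 0] by simp

lemma frob_ideal_1: "frob_ideal 1 = {x. \<pi> x = 0}"
  using F_frobenius by auto

lemma frob_ideal_antimono: "frob_ideal (Suc n) \<subseteq> frob_ideal n"
  by (induction n) auto

lemma subspace_frob_ideal: "ideal.subspace (frob_ideal n)"
proof (induction n)
  case 0
  show ?case by (simp add: ideal.subspace_def)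
next
  case (Suc n)
  show ?case
  proof (rule ideal.subspaceI)
    show "0 \<in> frob_ideal (Suc n)"
      using p_gt_0 ideal.subspace_0[OF Suc] by (auto simp: \<pi>_0 F_0 zero_power intro!: bexI[of _ 0])
  next
    fix x y assume x: "x \<in> frob_ideal (Suc n)" and y: "y \<in> frob_ideal (Suc n)"
    obtain s t where s: "s \<in> frob_ideal n" "F x = x ^ p + of_nat p * s"
      and t: "t \<in> frob_ideal n" "F y = y ^ p + of_nat p * t"
      using x y by auto
    obtain q where q: "(x + y) ^ p = x ^ p + y ^ p + of_nat p * (x * q)"
      by (rule binomial_prime_power[OF p])
    \<comment> \<open>The failure of \<open>\<delta>\<close> to be additive is
      \<open>- x * q\<close>.\<close>
    have "x * q \<in> frob_ideal n"
      using x frob_ideal_antimono ideal.subspace_scale[OF Suc, of x q] by (auto simp: mult.commute)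
    then have "s + t - x * q \<in> frob_ideal n"
      using s t ideal.subspace_add[OF Suc] ideal.subspace_diff[OF Suc] by blast
    moreover have "F (x + y) = (x + y) ^ p + of_nat p * (s + t - x * q)"
      unfolding F_add q s t by (simp add: algebra_simps)
    ultimately show "x + y \<in> frob_ideal (Suc n)"
      using x y by (auto simp: \<pi>_add)
  next
    fix r x assume x: "x \<in> frob_ideal (Suc n)"
    obtain s where s: "s \<in> frob_ideal n" "F x = x ^ p + of_nat p * s"
      using x by auto
    obtain q where q: "F r = r ^ p + of_nat p * q"
      using F_frobenius by blast
    have "x ^ p = x ^ (p - 1) * x"
      using p_gt_0 by (simp flip: power_Suc2)
    then have "x ^ p \<in> frob_ideal n"
      using subsetD[OF frob_ideal_antimono x] ideal.subspace_scale[OF Suc] by metis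
    \<comment> \<open>This is \<open>\<delta> (r * x)\<close>, with \<open>q = \<delta> r\<close>
      and \<open>s = \<delta> x\<close>.\<close>
    then have "q * x ^ p + F r * s \<in> frob_ideal n"
      using s ideal.subspace_add[OF Suc] ideal.subspace_scale[OF Suc] by blast
    moreover have "F (r * x) = (r * x) ^ p + of_nat p * (q * x ^ p + F r * s)"
      unfolding F_mult q s by (simp add: algebra_simps power_mult_distrib)
    ultimately show "r * x \<in> frob_ideal (Suc n)"
      using x by (auto simp: \<pi>_mult)
  qed
qed

text \<open>The product rule \<open>\<delta> (x * y) = \<delta> x * F y + x ^ p * \<delta> y\<close>
  drives the induction. The induction hypothesis handles \<open>x ^ p * \<delta> y\<close>, and also
  \<open>p * \<delta> y\<close> inside \<open>F y\<close>, because \<open>p\<close> lies in the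
  kernel of \<open>\<pi>\<close>.\<close>

lemma frob_ideal_mult:
  "x \<in> frob_ideal 1 \<Longrightarrow> y \<in> frob_ideal n \<Longrightarrow> x * y \<in> frob_ideal (Suc n)"
proof (induction n arbitrary: x y)
  case 0
  then show ?case
    using ideal.subspace_scale[OF subspace_frob_ideal, of x 1 y] by (simp add: mult.commute)
next
  case (Suc n)
  obtain s where s: "F x = x ^ p + of_nat p * s"
    using F_frobenius by blast
  obtain t where t: "t \<in> frob_ideal n" "F y = y ^ p + of_nat p * t"
    using Suc.prems by auto
  note sub = subspace_frob_ideal[of "Suc n"]
  have "y ^ p = y ^ (p - 1) * y"
    using p_gt_0 by (simp flip: power_Suc2)
  then have "y ^ p \<in> frob_ideal (Suc n)"
    using Suc.prems ideal.subspace_scale[OF sub] by metis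
  moreover have "of_nat p * t \<in> frob_ideal (Suc n)"
    by (rule Suc.IH) (use t \<pi>_p in \<open>simp_all only: frob_ideal_1 mem_Collect_eq\<close>)
  ultimately have "F y \<in> frob_ideal (Suc n)"
    unfolding t by (rule ideal.subspace_add[OF sub])
  moreover have "x ^ p * t \<in> frob_ideal (Suc n)"
  proof (rule Suc.IH)
    have "x ^ p = x ^ (p - 1) * x"
      using p_gt_0 by (simp flip: power_Suc2)
    then show "x ^ p \<in> frob_ideal 1"
      using Suc.prems ideal.subspace_scale[OF subspace_frob_ideal] by metis
  qed (fact t)
  ultimately have "s * F y + x ^ p * t \<in> frob_ideal (Suc n)"
    using ideal.subspace_add[OF sub] ideal.subspace_scale[OF sub] by blast
  moreover have "F (x * y) = (x * y) ^ p + of_nat p * (s * F y + x ^ p * t)"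
    unfolding F_mult s t by (simp add: algebra_simps power_mult_distrib)
  moreover have "\<pi> (x * y) = 0"
    using Suc.prems by (simp add: \<pi>_mult frob_ideal_1)
  ultimately show ?case
    by (auto simp del: frob_ideal.simps simp add: frob_ideal.simps(2)[of "Suc n"])
qed

lemma ideal_filtration_frob_ideal: "ideal_filtration \<pi> frob_ideal"
  unfolding ideal_filtration_def
  using subspace_frob_ideal frob_ideal_1 frob_ideal_mult by auto

text \<open>On an integer \<open>c\<close> divisible by \<open>p\<close>,
  \<open>\<delta> c = c * (1 - c ^ (p - 1)) / p\<close> with the bracket prime to \<open>p\<close>.
  So each application of \<open>\<delta>\<close> costs exactly one factor \<open>p\<close>.\<close>

lemma of_int_frob_ideal:
  assumes F_int: "\<And>c. F (of_int c) = of_int c"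
    and \<pi>_int: "\<And>c. \<pi> (of_int c) = 0 \<Longrightarrow> int p dvd c"
    and cancel: "\<And>a y. (of_int a :: 'r) = of_nat p * y \<Longrightarrow> \<exists>b. a = int p * b \<and> y = of_int b"
  shows "of_int c \<in> frob_ideal n \<Longrightarrow> int p ^ n dvd c"
proof (induction n arbitrary: c)
  case (Suc n)
  then obtain y where y: "y \<in> frob_ideal n" "of_int c = (of_int c :: 'r) ^ p + of_nat p * y"
    and \<pi>c: "\<pi> (of_int c) = 0"
    by (auto simp: F_int)
  from \<pi>_int[OF \<pi>c] have pc: "int p dvd c" .
  have "(of_int (c - c ^ p) :: 'r) = of_nat p * y"
    using y(2) by (simp add: algebra_simps)
  from cancel[OF this] obtain b where b: "c - c ^ p = int p * b" "y = of_int b" by blast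
  have "int p ^ n dvd b"
    using Suc.IH y b by simp
  then have "int p ^ Suc n dvd c - c ^ p"
    unfolding b by simp
  also have "c - c ^ p = c * (1 - c ^ (p - 1))"
    using p_gt_0 by (simp add: right_diff_distrib flip: power_Suc)
  finally have *: "int p ^ Suc n dvd c * (1 - c ^ (p - 1))" .
  have "1 < p" by (rule prime_gt_1_nat[OF p])
  have "coprime (int p) (1 - c ^ (p - 1))"
  proof (rule prime_imp_coprime)
    show "prime (int p)" using p by simp
    show "\<not> int p dvd 1 - c ^ (p - 1)"
    proof
      assume "int p dvd 1 - c ^ (p - 1)"
      moreover have "int p dvd c ^ (p - 1)"
        using pc \<open>1 < p\<close> by (intro dvd_power_le[of _ _ 1, simplified]) auto
      ultimately have "int p dvd 1 - c ^ (p - 1) + c ^ (p - 1)"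
        by (rule dvd_add)
      then show False using \<open>1 < p\<close> by simp
    qed
  qed
  then have "coprime (int p ^ Suc n) (1 - c ^ (p - 1))"
    by (metis coprime_power_left_iff)
  with * show ?case
    by (simp only: coprime_dvd_mult_left_iff)
qed simp

end

section \<open>Integral moment weights\<close>

text \<open>The quotient is the integral of \<open>x^k (1 - x)^m\<close> over the unit interval, and
  the induction writes \<open>x^(k+1) (1 - x)^m\<close> as
  \<open>x^k (1 - x)^m - x^k (1 - x)^(m+1)\<close>. Hence a common multiple of
  \<open>1, ..., M\<close> clears the denominator, which is much smaller than a factorial.\<close>

lemma beta_mult_Ints:
  fixes L :: nat
  assumes "\<And>j. 1 \<le> j \<Longrightarrow> j \<le> M \<Longrightarrow> j dvd L" and "k + m + 1 \<le> M"
  shows "real L * (fact k * fact m / fact (k + m + 1)) \<in> \<int>"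
  using assms(2)
proof (induction k arbitrary: m)
  case 0
  then obtain q where "L = (m + 1) * q"
    using assms(1)[of "m + 1"] by (auto elim: dvdE)
  then have "real L * (fact 0 * fact m / fact (0 + m + 1)) = of_nat q"
  proof -
    have "fact (0 + m + 1) = real (m + 1) * fact m" by simp
    moreover have "real (m + 1) \<noteq> 0" by simp
    ultimately show ?thesis
      unfolding \<open>L = (m + 1) * q\<close> of_nat_mult by (simp del: of_nat_add of_nat_Suc)
  qed
  then show ?case by simp
next
  case (Suc k)
  have "real L * (fact k * fact m / fact (k + m + 1)) - real L * (fact k * fact (m + 1) / fact (k + (m + 1) + 1)) \<in> \<int>"
    by (intro Ints_diff Suc.IH) (use Suc.prems in auto)
  also have "real L * (fact k * fact m / fact (k + m + 1)) - real L * (fact k * fact (m + 1) / fact (k + (m + 1) + 1))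
      = real L * (fact (Suc k) * fact m / fact (Suc k + m + 1))"
  proof -
    define D :: real where "D = fact (k + m + 1)"
    have E: "fact (k + (m + 1) + 1) = (real k + real m + 2) * D"
      "fact (Suc k + m + 1) = (real k + real m + 2) * D"
      "fact (m + 1) = (real m + 1) * fact m" "fact (Suc k) = (real k + 1) * fact k"
      by (simp_all add: D_def)
    define N where "N = real k + real m + 2"
    have "D \<noteq> 0" "N \<noteq> 0"
      by (simp_all add: D_def N_def add_nonneg_eq_0_iff)
    then have "real L * (fact k * fact m / D) - real L * (fact k * ((real m + 1) * fact m) / (N * D)) =
        real L * (fact k * fact m) * (N - (real m + 1)) / (N * D)"
      by (simp add: field_simps)
    then show ?thesis
      unfolding E D_def[symmetric] N_def by (simp add: mult_ac)
  qed
  finally show ?case .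
qed

text \<open>Each new variable contributes one Beta quotient and one factor \<open>L\<close>.\<close>

lemma dirichlet_mult_Ints:
  fixes L :: nat and b :: "'n \<Rightarrow> nat"
  assumes L: "\<And>j. 1 \<le> j \<Longrightarrow> j \<le> M \<Longrightarrow> j dvd L"
  shows "finite S \<Longrightarrow> card S + sum b S \<le> M \<Longrightarrow>
    real L ^ card S * ((\<Prod>i\<in>S. fact (b i)) / fact (card S + sum b S)) \<in> \<int>"
proof (induction S rule: finite_induct)
  case (insert x S)
  let ?m = "card S + sum b S"
  have "real L * (fact (b x) * fact ?m / fact (b x + ?m + 1)) \<in> \<int>"
    by (rule beta_mult_Ints[OF L]) (use insert in auto)
  moreover have "real L ^ card S * ((\<Prod>i\<in>S. fact (b i)) / fact ?m) \<in> \<int>"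
    using insert by auto
  ultimately have "real L * (fact (b x) * fact ?m / fact (b x + ?m + 1)) *
      (real L ^ card S * ((\<Prod>i\<in>S. fact (b i)) / fact ?m)) \<in> \<int>"
    by (rule Ints_mult)
  also have "real L * (fact (b x) * fact ?m / fact (b x + ?m + 1)) *
      (real L ^ card S * ((\<Prod>i\<in>S. fact (b i)) / fact ?m)) =
    real L ^ card (insert x S) * ((\<Prod>i\<in>insert x S. fact (b i)) / fact (b x + ?m + 1))"
    using insert by simp
  also have "b x + ?m + 1 = card (insert x S) + sum b (insert x S)"
    using insert by simp
  finally show ?case .
qed simp

text \<open>The \<open>p\<close>-part of the least common multiple already divides one of the
  numbers, so its valuation is logarithmic in \<open>M\<close>. The maximum with 1 covers the empty
  range.\<close>

lemma prime_power_dvd_Lcm: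
  fixes p :: nat
  assumes p: "prime p"
  shows "p ^ multiplicity p (Lcm {1..M}) \<le> max M 1"
proof (induction M)
  case (Suc M)
  have "{1..Suc M} = insert (Suc M) {1..M}" by auto
  then have L: "Lcm {1..Suc M} = lcm (Suc M) (Lcm {1..M})" by simp
  have "Lcm {1..M} \<noteq> 0" by (simp add: Lcm_0_iff)
  then have "multiplicity p (Lcm {1..Suc M}) = max (multiplicity p (Suc M)) (multiplicity p (Lcm {1..M}))"
    unfolding L by (intro multiplicity_lcm) (use p in auto)
  moreover have "p ^ multiplicity p (Suc M) \<le> Suc M"
    by (rule dvd_imp_le[OF multiplicity_dvd]) simp
  ultimately show ?case
    using Suc by (auto simp: max_def split: if_splits)
qed simp

text \<open>The weights are \<open>L^n * b! / (n + |b|)!\<close>. The second property makes the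
  weight at 0 nonzero and bounds its \<open>p\<close>-adic valuation by \<open>n\<close> times that
  of \<open>L\<close>.\<close>

lemma ex_moment_weights:
  fixes d :: nat
  obtains c :: "('n::finite \<Rightarrow> nat) \<Rightarrow> int"
  where "moment_weights d c"
    and "c (\<lambda>_. 0) * fact CARD('n) = int (Lcm {1..CARD('n) + d}) ^ CARD('n)"
proof -
  define L where "L = Lcm {1..CARD('n) + d}"
  define K where "K b = real L ^ CARD('n) * ((\<Prod>i\<in>UNIV. fact (b i)) / fact (CARD('n) + sum b UNIV))"
    for b :: "'n \<Rightarrow> nat"
  \<comment> \<open>The floor only changes the type: \<open>K b\<close> is an integer whenever
    \<open>|b| \<le> d\<close>.\<close>
  define c where "c b = \<lfloor>K b\<rfloor>" for b
  have L: "j dvd L" if "1 \<le> j" "j \<le> CARD('n) + d" for j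
    unfolding L_def by (rule dvd_Lcm) (use that in auto)
  have c: "real_of_int (c b) = K b" if "sum b UNIV \<le> d" for b
    using dirichlet_mult_Ints[of "CARD('n) + d" L UNIV b, OF L] that
    by (auto simp: c_def K_def elim: Ints_cases)
  show thesis
  proof (rule that[of c])
    show "moment_weights d c"
      unfolding moment_weights_def
    proof (intro allI impI)
      fix b :: "'n \<Rightarrow> nat" and i
      assume b: "sum b UNIV < d"
      let ?b = "b(i := Suc (b i))"
      have s: "sum ?b UNIV = Suc (sum b UNIV)"
        by (simp add: sum.remove[of UNIV i])
      have P: "(\<Prod>l\<in>UNIV. fact (?b l)) = real (b i + 1) * (\<Prod>l\<in>UNIV. fact (b l))"
        by (simp add: prod.remove[of UNIV i])
      have "real (CARD('n) + sum b UNIV + 1) * K ?b = real (b i + 1) * K b"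
      proof -
        have "fact (CARD('n) + sum ?b UNIV) = real (CARD('n) + sum b UNIV + 1) * fact (CARD('n) + sum b UNIV)"
          unfolding s by simp
        moreover have "real (CARD('n) + sum b UNIV + 1) \<noteq> 0"
          unfolding of_nat_eq_0_iff by simp
        ultimately show ?thesis
          unfolding K_def P by (simp only:) (simp add: field_simps del: of_nat_add of_nat_Suc)
      qed
      then have "real_of_int (int (CARD('n) + sum b UNIV + 1) * c ?b) = real_of_int (int (b i + 1) * c b)"
        using b by (simp only: of_int_mult of_int_of_nat_eq c s)
      then show "int (CARD('n) + sum b UNIV + 1) * c ?b = int (b i + 1) * c b"
        by (simp only: of_int_eq_iff)
    qed
    have "real_of_int (c (\<lambda>_. 0) * fact CARD('n)) = real_of_int (int L ^ CARD('n))"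
      by (simp add: c K_def)
    then show "c (\<lambda>_. 0) * fact CARD('n) = int (Lcm {1..CARD('n) + d}) ^ CARD('n)"
      unfolding L_def of_int_eq_iff .
  qed
qed

lemma ex_linear_less_power2: "\<exists>t. a * t + b < (2::nat) ^ t"
proof
  \<comment> \<open>Cubing \<open>?s + 1 \<le> 2 ^ ?s\<close> gives a cubic lower bound for
    \<open>2 ^ t\<close> at \<open>t = 3 * ?s\<close>.\<close>
  let ?s = "a + b + 1"
  have "?s + 1 \<le> 2 ^ ?s"
    using less_exp[of ?s] by simp
  then have "(?s + 1) ^ 3 \<le> (2 ^ ?s) ^ 3"
    by (rule power_mono) simp
  also have "\<dots> = 2 ^ (3 * ?s)"
    by (simp only: power_mult[symmetric] mult.commute)
  finally have "(?s + 1) ^ 3 \<le> 2 ^ (3 * ?s)" .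
  moreover have "a * (3 * ?s) + b < (?s + 1) ^ 3"
    by (simp add: power3_eq_cube algebra_simps)
  ultimately show "a * (3 * ?s) + b < 2 ^ (3 * ?s)"
    by linarith
qed

section \<open>A polynomial retraction onto the quadric bounds the moment of 1\<close>

lemma ex_deg_le_finite: "finite S \<Longrightarrow> \<exists>d. \<forall>P\<in>S. deg_le d P"
proof (induction S rule: finite_induct)
  case (insert P S)
  then obtain d where d: "\<forall>Q\<in>S. deg_le d Q" by blast
  obtain e where e: "deg_le e P" using ex_deg_le by blast
  have "\<forall>Q\<in>insert P S. deg_le (max d e) Q"
    using d e deg_le_mono by (metis insert_iff max.cobounded1 max.cobounded2)
  then show ?case by blast
qed simp

lemma power_coeffs_in:
  fixes v :: "'m::comm_monoid_add \<Rightarrow>\<^sub>0 'r::comm_ring_1"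
  assumes J: "ideal_filtration \<pi> J" and v: "v \<in> coeffs_in (J 1)"
  shows "v ^ N \<in> coeffs_in (J N)"
proof (induction N)
  case 0
  then show ?case using J by (simp add: ideal_filtration_def coeffs_in_def)
next
  case (Suc N)
  have "v * v ^ N \<in> coeffs_in (J (Suc N))"
    by (rule coeffs_in_mult_gen[OF _ _ v Suc]) (use J in \<open>auto simp: ideal_filtration_def\<close>)
  then show ?case by simp
qed

text \<open>Here \<open>v\<close> is the defect of unimodularity after lifting coefficients. The
  degree required of the weights grows only linearly in \<open>N\<close>.\<close>

lemma retraction_moment:
  fixes A R :: "'n::finite \<Rightarrow> ('n, 'r::comm_ring_1) two_family_poly"
    and c :: "('n \<Rightarrow> nat) \<Rightarrow> int"
  defines "h \<equiv> \<lambda>i. X i + quadric * A i"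
  assumes v: "v = (\<Sum>i\<in>UNIV. h i * R i) - 1"
    and D: "1 \<le> D" "deg_le D (quadric :: ('n, 'r) two_family_poly)" "deg_le D v" "\<And>i. deg_le D (A i)" "\<And>i. deg_le D (R i)"
      "deg_le D (1 + (\<Sum>i\<in>UNIV. Y i * A i))"
    and J: "ideal_filtration \<pi> J" and vJ: "v \<in> coeffs_in (J 1)"
    and c: "moment_weights d c" and d: "CARD('n) * (D * (N + 3)) \<le> d"
  shows "of_int (c (\<lambda>_. 0)) \<in> J N"
proof -
  have I: "ideal.subspace (J N)" using J by (simp add: ideal_filtration_def)
  \<comment> \<open>\<open>G\<close> inverts \<open>1 + v\<close> up to the error
    \<open>(- v) ^ N\<close>.\<close>
  define G where "G = (\<Sum>j<N. (- v) ^ j)"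
  \<comment> \<open>Chosen so that \<open>quadric * t\<close> is the defect of
    \<open>\<Sum> Y i * h i\<close> from 1, which \<open>u\<close> then corrects.\<close>
  define t where "t = - (1 + (\<Sum>i\<in>UNIV. Y i * A i))"
  define g where "g = case_sum A (\<lambda>i. t * (R i * G))"
  define u where "u i = Y i + quadric * (t * (R i * G))" for i
  define w where "w = - ((- v) ^ N * (quadric * t))"
  have hY: "(\<Sum>i\<in>UNIV. Y i * h i) = 1 - quadric * t"
  proof -
    have "(\<Sum>i\<in>UNIV. Y i * h i) = (\<Sum>i\<in>UNIV. X i * Y i) + quadric * (\<Sum>i\<in>UNIV. Y i * A i)"
      by (simp add: h_def distrib_left sum.distrib sum_distrib_left mult_ac)
    also have "(\<Sum>i\<in>UNIV. X i * Y i) = (quadric + 1 :: ('n, 'r) two_family_poly)"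
      by (simp add: quadric_def)
    finally show ?thesis
      by (simp add: t_def algebra_simps)
  qed
  have hR: "(\<Sum>i\<in>UNIV. h i * (R i * G)) = 1 - (- v) ^ N"
  proof -
    have "(\<Sum>i\<in>UNIV. h i * (R i * G)) = (1 - (- v)) * G"
    proof -
    have "(\<Sum>i\<in>UNIV. h i * (R i * G)) = (\<Sum>i\<in>UNIV. h i * R i) * G"
      by (simp only: sum_distrib_right mult.assoc)
    then show ?thesis by (simp add: v)
  qed
    then show ?thesis
      unfolding G_def one_diff_power_eq .
  qed
  have "(\<Sum>i\<in>UNIV. h i * u i) = (\<Sum>i\<in>UNIV. Y i * h i) + quadric * t * (\<Sum>i\<in>UNIV. h i * (R i * G))"
    unfolding u_def by (simp add: distrib_left sum.distrib sum_distrib_left mult_ac)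
  also have "\<dots> = 1 + w"
    unfolding hY hR w_def by (simp add: algebra_simps)
  finally have rel: "(\<Sum>i\<in>UNIV. h i * u i) = 1 + w" .
  have "- v \<in> coeffs_in (J 1)"
    using vJ J ideal.subspace_neg[of "J 1"] by (auto simp: coeffs_in_def ideal_filtration_def)
  from power_coeffs_in[OF J this, of N] have "w \<in> coeffs_in (J N)"
    unfolding w_def using coeffs_in_mult[OF I _, of "(- v) ^ N" "- (quadric * t)"]
    by (simp add: mult.commute)
  from det_jacobian_relation[OF I this rel]
  have det: "det (jacobian (case_sum h u)) \<in> coeffs_in (J N)" .
  have \<phi>: "case_sum h u = (\<lambda>i. mvar i + quadric * g i)"
    by (auto simp: fun_eq_iff h_def u_def g_def mvar_def X_def Y_def split: sum.split)
  have "deg_le (N * D) G"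
    unfolding G_def
  proof (rule deg_le_sum)
    fix j assume "j \<in> {..<N}"
    then have "j * D \<le> N * D" by simp
    then show "deg_le (N * D) ((- v) ^ j)"
      using deg_le_power[OF deg_le_uminus[OF D(3)], of j] deg_le_mono by blast
  qed
  \<comment> \<open>The factors \<open>t\<close>, \<open>R i\<close> and \<open>G\<close> contribute
    \<open>D\<close>, \<open>D\<close> and \<open>N * D\<close>; multiplying by
    \<open>quadric\<close> later brings the total to \<open>D * (N + 3)\<close>.\<close>
  then have "deg_le (D + (D + N * D)) (t * (R i * G))" for i
    unfolding t_def by (intro deg_le_mult deg_le_uminus D)
  then have tRG: "deg_le (D * (N + 2)) (t * (R i * G))" for i
    by (simp add: algebra_simps)
  have g: "deg_le (D * (N + 2)) (g i)" for i
    using tRG deg_le_mono[OF D(4), of "D * (N + 2)"] by (auto simp: g_def split: sum.split)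
  have g': "deg_le (D * (N + 3)) (g i)" for i
    by (rule deg_le_mono[OF g]) (simp add: algebra_simps)
  have qg: "deg_le (D * (N + 3)) (quadric * g i)" for i
  proof (rule deg_le_mono[OF deg_le_mult[OF D(2) g[of i]]])
    show "D + D * (N + 2) \<le> D * (N + 3)" by (simp add: algebra_simps)
  qed
  have mv: "deg_le (D * (N + 3)) (mvar i :: ('n, 'r) two_family_poly)" for i
    unfolding mvar_def using D(1) by (intro deg_le_single) simp
  have "moment c (det (jacobian (\<lambda>i. mvar i + quadric * g i))) = of_int (c (\<lambda>_. 0))"
    by (rule moment_det_jacobian_retraction[OF c d])
      (use D(1) g' qg mv in \<open>simp_all add: deg_le_add\<close>)
  then show ?thesis
    using moment_in[OF I det, of c] by (simp only: \<phi>)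
qed

text \<open>\<open>D\<close> depends only on the lifted polynomials. It is obtained before
  \<open>J\<close>, \<open>N\<close>, \<open>d\<close> and \<open>c\<close>, which lets
  \<open>N\<close> be chosen in terms of \<open>D\<close>.\<close>

lemma unimodular_lift_moment:
  fixes \<pi> :: "'r::comm_ring_1 \<Rightarrow> 'k::comm_ring_1"
    and a r :: "'n::finite \<Rightarrow> ('n, 'k) two_family_poly"
  assumes \<pi>_add: "\<And>x y. \<pi> (x + y) = \<pi> x + \<pi> y" and \<pi>_mult: "\<And>x y. \<pi> (x * y) = \<pi> x * \<pi> y"
    and \<pi>_1: "\<pi> 1 = 1" and surj: "surj \<pi>"
    and unimodular: "(\<Sum>i\<in>UNIV. (X i + quadric * a i) * r i) = 1"
  obtains D where "\<And>J N d (c :: ('n \<Rightarrow> nat) \<Rightarrow> int). \<lbrakk>ideal_filtration \<pi> J; moment_weights d c;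
    CARD('n) * (D * (N + 3)) \<le> d\<rbrakk> \<Longrightarrow> of_int (c (\<lambda>_. 0)) \<in> J N"
proof -
  let ?\<kappa> = "\<lambda>c. Poly_Mapping.single (0 :: 'n + 'n \<Rightarrow>\<^sub>0 nat) (\<pi> c)"
  let ?\<eta> = "\<lambda>m :: 'n + 'n \<Rightarrow>\<^sub>0 nat. Poly_Mapping.single m (1 :: 'k)"
  define red where "red = poly_subst ?\<kappa> ?\<eta>"
  interpret hom: poly_subst_hom ?\<kappa> ?\<eta>
    by standard (simp_all add: \<pi>_add \<pi>_mult \<pi>_1 single_add mult_single)
  note red_simps = hom.subst_add[folded red_def] hom.subst_mult[folded red_def] hom.subst_1[folded red_def]
    hom.subst_diff[folded red_def] hom.subst_sum[folded red_def] hom.subst_0[folded red_def]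
  have red_single: "red (Poly_Mapping.single m c) = Poly_Mapping.single m (\<pi> c)" for m c
    by (simp add: red_def hom.subst_single mult_single)
  have red_lookup: "Poly_Mapping.lookup (red P) m = \<pi> (Poly_Mapping.lookup P m)" for P m
  proof (induction P rule: poly_mapping_single_induct)
    case (single k)
    have "\<pi> 0 = 0" using \<pi>_add[of 0 0] by simp
    then show ?case by (simp add: red_single lookup_single when_def)
  next
    case zero
    have "\<pi> 0 = 0" using \<pi>_add[of 0 0] by simp
    then show ?case by (simp add: red_simps)
  qed (simp add: red_simps lookup_add \<pi>_add)
  have red_surj: "\<exists>P'. red P' = P" for P
  proof (induction P rule: poly_mapping_single_induct)
    case (single m)
    obtain b where "\<pi> b = Poly_Mapping.lookup P m" using surj by (metis surjD)
    then show ?case using red_single by metis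
  next
    case zero
    show ?case using red_simps by blast
  next
    case (add P Q)
    then show ?case using red_simps(1) by metis
  qed
  have "\<forall>i. \<exists>P. red P = a i" "\<forall>i. \<exists>P. red P = r i"
    using red_surj by blast+
  then obtain A R where A: "\<And>i. red (A i) = a i" and R: "\<And>i. red (R i) = r i"
    by metis
  have XY: "red (X i) = X i" "red (Y i) = Y i" for i
    by (simp_all add: X_def Y_def red_single \<pi>_1)
  have Q: "red quadric = quadric"
    by (simp add: quadric_def red_simps XY)
  define v where "v = (\<Sum>i\<in>UNIV. (X i + quadric * A i) * R i) - 1"
  have "red v = 0"
    by (simp add: v_def red_simps XY Q A R unimodular)
  then have "\<pi> (Poly_Mapping.lookup v m) = 0" for m
    using red_lookup[of v m] by simp
  then have vJ: "v \<in> coeffs_in (J 1)" if "ideal_filtration \<pi> J" for J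
    using that by (auto simp: ideal_filtration_def coeffs_in_def)
  let ?S = "range A \<union> range R \<union> {quadric, v, 1 + (\<Sum>i\<in>UNIV. Y i * A i)}"
  have "finite ?S" by simp
  from ex_deg_le_finite[OF this] obtain D0 where D0: "\<forall>P\<in>?S. deg_le D0 P" ..
  \<comment> \<open>The maximum with 1 accommodates the variables, which have degree 1.\<close>
  define D where "D = max 1 D0"
  have D: "\<forall>P\<in>?S. deg_le D P"
  proof
    fix P assume "P \<in> ?S"
    with D0 have "deg_le D0 P" by (rule bspec)
    then show "deg_le D P" unfolding D_def by (rule deg_le_mono) simp
  qed
  show thesis
  proof (rule that[of D])
    fix J N d and c :: "('n \<Rightarrow> nat) \<Rightarrow> int"
    assume *: "ideal_filtration \<pi> J" "moment_weights d c" "CARD('n) * (D * (N + 3)) \<le> d"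
    show "of_int (c (\<lambda>_. 0)) \<in> J N"
      by (rule retraction_moment[OF v_def _ _ _ _ _ _ *(1) vJ[OF *(1)] *(2,3)])
        (use D in \<open>auto simp: D_def\<close>)
  qed
qed

section \<open>The polynomial ring over the integers with one variable for each element of the field\<close>

text \<open>A torsion-free ring that maps onto the field and carries a lift of Frobenius, raising
  each variable to its \<open>p\<close>-th power.\<close>

type_synonym 'k lift_ring = "('k \<Rightarrow>\<^sub>0 nat) \<Rightarrow>\<^sub>0 int"

definition monomial_value :: "('k::comm_ring_1 \<Rightarrow>\<^sub>0 nat) \<Rightarrow> 'k"
  where "monomial_value m = (\<Prod>x\<in>Poly_Mapping.keys m. x ^ Poly_Mapping.lookup m x)"

lemma monomial_value_add: "monomial_value (m + m') = monomial_value m * monomial_value m'"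
proof -
  let ?S = "Poly_Mapping.keys m \<union> Poly_Mapping.keys m'"
  have *: "monomial_value k = (\<Prod>x\<in>?S. x ^ Poly_Mapping.lookup k x)"
    if "Poly_Mapping.keys k \<subseteq> ?S" for k
    unfolding monomial_value_def using that
    by (intro prod.mono_neutral_left) (auto simp: in_keys_iff)
  have "Poly_Mapping.keys (m + m') \<subseteq> ?S"
    by (rule Poly_Mapping.keys_add)
  then show ?thesis
    by (simp add: * lookup_add power_add prod.distrib)
qed

definition evaluation :: "'k::comm_ring_1 lift_ring \<Rightarrow> 'k"
  where "evaluation = poly_subst of_int monomial_value"

interpretation evaluation: poly_subst_hom "of_int :: int \<Rightarrow> 'k::comm_ring_1" monomial_value
  by standard (simp_all add: monomial_value_add, simp add: monomial_value_def)

lemmas evaluation_simps = evaluation.subst_add evaluation.subst_mult evaluation.subst_1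
  evaluation.subst_of_int evaluation.subst_of_nat

lemma surj_evaluation: "surj (evaluation :: 'k lift_ring \<Rightarrow> 'k::comm_ring_1)"
proof (rule surjI)
  show "evaluation (Poly_Mapping.single (Poly_Mapping.single x 1) 1) = x" for x :: 'k
    by (simp add: evaluation_def evaluation.subst_single monomial_value_def)
qed

definition frobenius :: "nat \<Rightarrow> 'k lift_ring \<Rightarrow> 'k lift_ring"
  where "frobenius p = poly_subst of_int (\<lambda>m. Poly_Mapping.single m 1 ^ p)"

interpretation frobenius: poly_subst_hom "of_int :: int \<Rightarrow> 'k lift_ring"
  "\<lambda>m :: 'k \<Rightarrow>\<^sub>0 nat. Poly_Mapping.single m (1 :: int) ^ p" for p
  by standard (simp_all add: mult_single flip: power_mult_distrib)

text \<open>The congruence is an equality on monomials and passes to sums and negatives, hence to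
  all integer combinations.\<close>

lemma frobenius_congruence:
  assumes p: "prime p"
  shows "\<exists>y. frobenius p x = x ^ p + of_nat p * y"
proof -
  have add: "\<exists>z. frobenius p (x + y) = (x + y) ^ p + of_nat p * z"
    if xy: "\<exists>z. frobenius p x = x ^ p + of_nat p * z" "\<exists>z. frobenius p y = y ^ p + of_nat p * z"
    for x y :: "'a lift_ring"
  proof -
    obtain s t where st: "frobenius p x = x ^ p + of_nat p * s" "frobenius p y = y ^ p + of_nat p * t"
      using xy by blast
    obtain q where q: "(x + y) ^ p = x ^ p + y ^ p + of_nat p * (x * q)"
      by (rule binomial_prime_power[OF p])
    have "frobenius p (x + y) = (x + y) ^ p + of_nat p * (s + t - x * q)"
      using st unfolding q by (simp add: frobenius_def frobenius.subst_add algebra_simps)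
    then show ?thesis by blast
  qed
  have p0: "0 < p" using p by (simp add: prime_gt_0_nat)
  then have zero: "\<exists>z. frobenius p 0 = 0 ^ p + of_nat p * z"
    by (intro exI[of _ 0]) (simp add: frobenius_def frobenius.subst_0 zero_power)
  have neg: "\<exists>z. frobenius p (- x) = (- x) ^ p + of_nat p * z"
    if x: "\<exists>z. frobenius p x = x ^ p + of_nat p * z" for x :: "'a lift_ring"
  proof -
    obtain s where s: "frobenius p x = x ^ p + of_nat p * s"
      using x by blast
    \<comment> \<open>Using the expansion of \<open>(x + - x) ^ p = 0\<close> treats
      \<open>p = 2\<close> together with the odd primes.\<close>
    obtain q where "(x + - x) ^ p = x ^ p + (- x) ^ p + of_nat p * (x * q)"
      by (rule binomial_prime_power[OF p])
    then have q: "(- x) ^ p = - (x ^ p) - of_nat p * (x * q)"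
      using p0 by (simp add: zero_power algebra_simps eq_neg_iff_add_eq_0)
    have "frobenius p (- x) = (- x) ^ p + of_nat p * (x * q - s)"
      using s unfolding q by (simp add: frobenius_def frobenius.subst_uminus algebra_simps)
    then show ?thesis by blast
  qed
  show ?thesis
  proof (induction x rule: poly_mapping_single_induct)
    case (single m)
    have one: "\<exists>z. frobenius p (Poly_Mapping.single m 1) = Poly_Mapping.single m 1 ^ p + of_nat p * z"
      by (intro exI[of _ 0]) (simp add: frobenius_def frobenius.subst_single)
    show "\<exists>z. frobenius p (Poly_Mapping.single m c) = Poly_Mapping.single m c ^ p + of_nat p * z" for c
    proof (induction c rule: int_induct[where k=0])
      case base
      show ?case using zero by simp
    next
      case (step1 c)
      then show ?case using add[OF step1(2) one] by (simp add: single_add)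
    next
      case (step2 c)
      then show ?case using add[OF step2(2) neg[OF one]] by (simp add: single_diff)
    qed
  next
    case zero
    show ?case by (rule \<open>\<exists>z. frobenius p 0 = 0 ^ p + of_nat p * z\<close>)
  next
    case (add a b)
    then show ?case by (rule \<open>\<And>x y. _ \<Longrightarrow> _ \<Longrightarrow> \<exists>z. frobenius p (x + y) = (x + y) ^ p + of_nat p * z\<close>)
  qed
qed

text \<open>Comparison of coefficients: all those of \<open>y\<close> except the constant one
  vanish.\<close>

lemma of_int_eq_of_nat_mult_lift_ring:
  assumes "(of_int a :: 'k lift_ring) = of_nat p * y" and "0 < p"
  shows "\<exists>b. a = int p * b \<and> y = of_int b"
proof -
  have single: "Poly_Mapping.single 0 z = (of_int z :: 'k lift_ring)" for z
    by (metis id_apply of_int_eq_id single_of_int)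
  have "Poly_Mapping.single 0 a = Poly_Mapping.single 0 (int p) * y"
    using assms by (simp add: single)
  also have "\<dots> = Poly_Mapping.map ((*) (int p)) y"
    by (rule mult_map_scale_conv_mult[symmetric])
  finally have *: "Poly_Mapping.lookup (Poly_Mapping.single 0 a) m = int p * Poly_Mapping.lookup y m" for m
    by (simp add: map.rep_eq when_def)
  have "a = int p * Poly_Mapping.lookup y 0"
    using *[of 0] by simp
  moreover have "y = Poly_Mapping.single 0 (Poly_Mapping.lookup y 0)"
  proof (rule poly_mapping_eqI)
    show "Poly_Mapping.lookup y m = Poly_Mapping.lookup (Poly_Mapping.single 0 (Poly_Mapping.lookup y 0)) m" for m
      using *[of m] assms(2) by (auto simp: lookup_single when_def split: if_splits)
  qed
  ultimately show ?thesis
    unfolding single by blast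
qed

theorem no_unimodular_lift:
  fixes a r :: "'n::finite \<Rightarrow> ('n, 'k::field) two_family_poly"
  shows "(\<Sum>i\<in>UNIV. (X i + quadric * a i) * r i) \<noteq> 1"
proof
  assume "(\<Sum>i\<in>UNIV. (X i + quadric * a i) * r i) = 1"
  then obtain D where D: "\<And>J N d (c :: ('n \<Rightarrow> nat) \<Rightarrow> int).
      \<lbrakk>ideal_filtration (evaluation :: 'k lift_ring \<Rightarrow> 'k) J; moment_weights d c;
       CARD('n) * (D * (N + 3)) \<le> d\<rbrakk> \<Longrightarrow> of_int (c (\<lambda>_. 0)) \<in> J N"
    by (rule unimodular_lift_moment[where \<pi> = "evaluation :: 'k lift_ring \<Rightarrow> 'k", rotated 4])
      (auto simp: evaluation_simps[folded evaluation_def] surj_evaluation)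
  define p where "p = CHAR('k)"
  have \<pi>_int: "evaluation (of_int m :: 'k lift_ring) = 0 \<longleftrightarrow> int p dvd m" for m
    by (simp add: evaluation_def evaluation.subst_of_int of_int_eq_0_iff_char_dvd p_def)
  show False
  proof (cases "p = 0")
    case True
    \<comment> \<open>In characteristic 0 no nonzero integer evaluates to 0, so membership of the
      nonzero weight in the kernel at \<open>N = 1\<close> is already contradictory.\<close>
    define J :: "nat \<Rightarrow> 'k lift_ring set" where "J n = (if n = 0 then UNIV else {x. evaluation x = 0})" for n
    have "ideal.subspace {x :: 'k lift_ring. evaluation x = 0}"
      by (rule ideal.subspaceI)
        (simp_all add: evaluation_def evaluation.subst_0 evaluation.subst_add evaluation.subst_mult)
    then have "ideal_filtration evaluation J"
      by (auto simp: ideal_filtration_def J_def ideal.subspace_UNIV evaluation_def evaluation.subst_mult)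
    moreover obtain c :: "('n \<Rightarrow> nat) \<Rightarrow> int"
      where c: "moment_weights (CARD('n) * (D * (1 + 3))) c"
        "c (\<lambda>_. 0) * fact CARD('n) = int (Lcm {1..CARD('n) + CARD('n) * (D * (1 + 3))}) ^ CARD('n)"
      by (rule ex_moment_weights)
    ultimately have "of_int (c (\<lambda>_. 0)) \<in> J 1"
      using D by blast
    then have "c (\<lambda>_. 0) = 0"
      using \<pi>_int True by (simp add: J_def)
    with c(2) have "Lcm {1..CARD('n) + CARD('n) * (D * (1 + 3))} = 0"
      by simp
    then show False by (simp only: Lcm_0_iff finite_atLeastAtMost) simp
  next
    case False
    then have p: "prime p"
      unfolding p_def by (intro prime_CHAR_semidom) simp
    interpret fl: frobenius_lift "evaluation :: 'k lift_ring \<Rightarrow> 'k" "frobenius p" p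
    proof
      show "evaluation (of_nat p :: 'k lift_ring) = 0"
        using \<pi>_int[of "int p"] by simp
    qed (use p frobenius_congruence[OF p] in \<open>auto simp: evaluation_def frobenius_def
          evaluation.subst_add evaluation.subst_mult frobenius.subst_add frobenius.subst_mult\<close>)
    let ?n = "CARD('n)"
    \<comment> \<open>The left side is \<open>n + d\<close> for the \<open>N\<close> and
      \<open>d\<close> below. With \<open>N = n * t\<close>, the divisibility of
      \<open>L ^ n\<close> by \<open>p ^ N\<close> forces \<open>p ^ t \<le> n + d\<close>, against
      this choice.\<close>
    obtain t where t: "?n * D * ?n * t + (?n + ?n * D * 3) < 2 ^ t"
      using ex_linear_less_power2 by blast
    define N where "N = ?n * t"
    define d where "d = ?n * (D * (N + 3))"
    obtain c :: "('n \<Rightarrow> nat) \<Rightarrow> int" where c: "moment_weights d c"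
        "c (\<lambda>_. 0) * fact ?n = int (Lcm {1..?n + d}) ^ ?n"
      by (rule ex_moment_weights)
    have "of_int (c (\<lambda>_. 0)) \<in> fl.frob_ideal N"
      by (rule D[OF fl.ideal_filtration_frob_ideal c(1)]) (simp add: d_def)
    then have "int p ^ N dvd c (\<lambda>_. 0)"
    proof (rule fl.of_int_frob_ideal[rotated 3])
      show "\<exists>b. a = int p * b \<and> y = of_int b"
        if "(of_int a :: 'k lift_ring) = of_nat p * y" for a y
        using of_int_eq_of_nat_mult_lift_ring[OF that] p by (simp add: prime_gt_0_nat)
    qed (simp_all add: \<pi>_int frobenius_def frobenius.subst_of_int)
    then have "int (p ^ N) dvd int (Lcm {1..?n + d} ^ ?n)"
      using c(2) by (metis dvd_mult2 of_nat_power)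
    then have "p ^ N dvd Lcm {1..?n + d} ^ ?n"
      by (simp only: int_dvd_int_iff)
    moreover have Lcm: "Lcm {1..?n + d} \<noteq> 0"
      by (simp add: Lcm_0_iff)
    ultimately have "N \<le> multiplicity p (Lcm {1..?n + d} ^ ?n)"
      using p by (intro multiplicity_geI) (auto simp: not_prime_unit)
    also have "\<dots> = ?n * multiplicity p (Lcm {1..?n + d})"
      using p Lcm by (intro prime_elem_multiplicity_power_distrib) auto
    finally have "t \<le> multiplicity p (Lcm {1..?n + d})"
      by (simp add: N_def)
    then have "p ^ t \<le> p ^ multiplicity p (Lcm {1..?n + d})"
      using prime_gt_0_nat[OF p] by (intro power_increasing) auto
    also have "\<dots> \<le> ?n + d"
    proof -
      have "1 \<le> ?n" by (simp add: Suc_le_eq)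
      then show ?thesis
        using prime_power_dvd_Lcm[OF p, of "?n + d"] by (simp only: max_absorb1 trans_le_add1)
    qed
    also have "\<dots> < 2 ^ t"
      using t by (simp add: d_def N_def algebra_simps)
    also have "(2::nat) ^ t \<le> p ^ t"
      using p by (intro power_mono) (auto simp: prime_ge_2_nat)
    finally show False by simp
  qed
qed

section \<open>Generators of the conormal module\<close>

text \<open>The constant term of \<open>quadric\<close> is -1 and its other terms have degree 2, so
  a term of \<open>P\<close> of least degree reappears, negated, in the product.\<close>

lemma quadric_mult_eq_0:
  fixes P :: "('n::finite, 'r::comm_ring_1) two_family_poly"
  assumes "quadric * P = 0"
  shows "P = 0"
proof (rule ccontr)
  assume "P \<noteq> 0"
  then have "Poly_Mapping.keys P \<noteq> {}" by simp
  then obtain m where m: "m \<in> Poly_Mapping.keys P"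
    and min: "\<And>k. k \<in> Poly_Mapping.keys P \<Longrightarrow> total m \<le> total k"
    using arg_min_if_finite[of "Poly_Mapping.keys P" total] by (metis finite_keys not_less)
  have "Poly_Mapping.lookup (X i * Y i * P) m = 0" for i
  proof (rule ccontr)
    assume "Poly_Mapping.lookup (X i * Y i * P) m \<noteq> 0"
    then have "m \<in> Poly_Mapping.keys (Poly_Mapping.single (XY_exp i) 1 * P)"
      by (simp add: X_def Y_def XY_exp_def mult_single in_keys_iff)
    then obtain k where "k \<in> Poly_Mapping.keys P" "m = XY_exp i + k"
      using Poly_Mapping.keys_mult[of "Poly_Mapping.single (XY_exp i) 1" P] by (auto split: if_splits)
    with min[of k] show False
      by (simp add: total_add XY_exp_def)
  qed
  then have "Poly_Mapping.lookup (quadric * P) m = - Poly_Mapping.lookup P m"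
    by (simp add: quadric_def left_diff_distrib sum_distrib_right lookup_minus lookup_sum)
  with assms m show False
    by (simp add: in_keys_iff)
qed

lemma mem_ideal_gen_singleton: "x \<in> ideal_gen {f} \<longleftrightarrow> (\<exists>r. x = r * f)"
  by (auto simp: ideal.span_singleton)

lemma ideal_square_principal: "x \<in> ideal_square (ideal_gen {f}) \<longleftrightarrow> (\<exists>r. x = r * (f * f))"
proof
  assume "x \<in> ideal_square (ideal_gen {f})"
  then show "\<exists>r. x = r * (f * f)"
    unfolding ideal_square_def
  proof (induction rule: ideal.span_induct_alt)
    case base
    show ?case by (rule exI[of _ 0]) simp
  next
    case (step c x y)
    then obtain r s t where "x = (r * f) * (s * f)" "y = t * (f * f)"
      by (auto simp: mem_ideal_gen_singleton)
    then show ?case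
      by (intro exI[of _ "c * r * s + t"]) (simp add: algebra_simps)
  qed
next
  assume "\<exists>r. x = r * (f * f)"
  then obtain r where "x = r * (f * f)" by blast
  moreover have "f * f \<in> ideal_square (ideal_gen {f})"
    unfolding ideal_square_def by (intro ideal.span_base CollectI exI conjI refl) (simp_all add: ideal.span_base)
  ultimately show "x \<in> ideal_square (ideal_gen {f})"
    unfolding ideal_square_def by (simp add: ideal.span_scale)
qed

lemma sum_cosets:
  fixes x :: "'i \<Rightarrow> 'a::comm_ring_1"
  assumes J: "ideal.subspace J"
  shows "finite S \<Longrightarrow> J + (\<Sum>i\<in>S. x i +o J) = (\<Sum>i\<in>S. x i) +o J"
proof (induction S rule: finite_induct)
  case empty
  show ?case by (simp add: elt_set_plus_def)
next
  case (insert i S)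
  have "J + (\<Sum>i\<in>insert i S. x i +o J) = J + ((x i +o J) + (\<Sum>i\<in>S. x i +o J))"
    using insert.hyps by simp
  also have "\<dots> = (x i +o J) + (J + (\<Sum>i\<in>S. x i +o J))"
    by (rule add.left_commute)
  also have "\<dots> = (x i + (\<Sum>i\<in>S. x i)) +o J"
    unfolding insert.IH by (rule coset_plus[OF J])
  finally show ?case
    using insert.hyps by simp
qed

text \<open>Since \<open>\<Sum> x i * y i = 1 + f\<close>, the combination of the
  \<open>x i * f\<close> with coefficients \<open>a * y i\<close> is
  \<open>a * f + a * (f * f)\<close>, which agrees with \<open>a * f\<close> modulo the
  square.\<close>

lemma generates_quotient_principal:
  fixes x y :: "'i::finite \<Rightarrow> 'a::comm_ring_1"
  assumes f: "f = (\<Sum>i\<in>UNIV. x i * y i) - 1"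
  shows "generates_quotient (ideal_gen {f}) (ideal_square (ideal_gen {f}))
    (\<lambda>i. (x i * f) +o ideal_square (ideal_gen {f}))"
proof -
  let ?J = "ideal_square (ideal_gen {f})"
  have J: "ideal.subspace ?J"
    by (simp add: ideal_square_def ideal.subspace_span)
  have "\<exists>r. C = ?J + (\<Sum>i\<in>UNIV. class_scale ?J (r i) ((x i * f) +o ?J))"
    if Cq: "C \<in> ideal_quotient (ideal_gen {f}) ?J" for C
  proof -
    obtain a where C: "C = (a * f) +o ?J"
      using Cq by (auto simp: ideal_quotient_def mem_ideal_gen_singleton)
    have "a * f - (\<Sum>i\<in>UNIV. a * y i * (x i * f)) = - a * f * ((\<Sum>i\<in>UNIV. x i * y i) - 1)"
    proof -
      have "(\<Sum>i\<in>UNIV. a * y i * (x i * f)) = a * f * (\<Sum>i\<in>UNIV. x i * y i)"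
        unfolding sum_distrib_left by (rule sum.cong) (simp_all add: mult_ac)
      then show ?thesis by (simp add: right_diff_distrib)
    qed
    then have "a * f - (\<Sum>i\<in>UNIV. a * y i * (x i * f)) = - a * (f * f)"
      unfolding f[symmetric] by (simp add: mult.assoc)
    then have "C = (\<Sum>i\<in>UNIV. a * y i * (x i * f)) +o ?J"
      unfolding C coset_eq_iff[OF J] ideal_square_principal by blast
    also have "\<dots> = ?J + (\<Sum>i\<in>UNIV. class_scale ?J (a * y i) ((x i * f) +o ?J))"
      by (simp add: coset_scale[OF J] sum_cosets[OF J])
    finally show ?thesis by (rule exI[of _ "\<lambda>i. a * y i"])
  qed
  moreover have "x i * f \<in> ideal_gen {f}" for i
    by (auto simp: mem_ideal_gen_singleton)
  ultimately show ?thesis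
    by (auto simp: generates_quotient_def ideal_quotient_def)
qed

theorem mainTheorem1:
  fixes f :: "('n::finite, 'k::field) two_family_poly"
    and I :: "('n, 'k) two_family_poly set"
  assumes "CARD('n) \<ge> 3"
    and "f = (\<Sum>i\<in>UNIV. X i * Y i) - 1"
    and "I = ideal_gen {f}"
  shows "generates_quotient I (ideal_square I) (\<lambda>i. (X i * f) +o ideal_square I) \<and>
    \<not> lifts_to_generators I (\<lambda>i. (X i * f) +o ideal_square I)"
proof
  show "generates_quotient I (ideal_square I) (\<lambda>i. (X i * f) +o ideal_square I)"
    unfolding assms(3) by (rule generates_quotient_principal[OF assms(2)])
  have f: "f = quadric"
    by (simp add: assms(2) quadric_def)
  show "\<not> lifts_to_generators I (\<lambda>i. (X i * f) +o ideal_square I)"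
    unfolding lifts_to_generators_iff
  proof
    assume "\<exists>g. (\<forall>i. g i \<in> I) \<and> I = ideal_gen (range g) \<and> (\<forall>i. g i - X i * f \<in> ideal_square I)"
    then obtain g where gen: "I = ideal_gen (range g)" and "\<forall>i. g i - X i * f \<in> ideal_square I"
      by blast
    then obtain a where a: "\<And>i. g i - X i * f = a i * (f * f)"
      unfolding assms(3) ideal_square_principal by metis
    have g: "g i = f * (X i + f * a i)" for i
      using a[of i] by (simp add: algebra_simps)
    have "\<exists>r. x = (\<Sum>i\<in>UNIV. r i * g i)" if "x \<in> ideal_gen (range g)" for x
      using that
    proof (induction rule: ideal.span_induct_alt)
      case base
      show ?case by (rule exI[of _ "\<lambda>_. 0"]) simp
    next
      case (step c x y)
      then obtain j r where "x = g j" "y = (\<Sum>i\<in>UNIV. r i * g i)" by auto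
      \<comment> \<open>The generators are indexed, possibly with repetitions; the new coefficient
        is assigned to one index \<open>j\<close> with \<open>x = g j\<close>.\<close>
      then have "c * x + y = (\<Sum>i\<in>UNIV. (r i + (if i = j then c else 0)) * g i)"
        by (simp add: distrib_right sum.distrib if_distrib[of "\<lambda>z. z * _"] cong: if_cong)
      then show ?case by (rule exI[of _ "\<lambda>i. r i + (if i = j then c else 0)"])
    qed
    moreover have "f \<in> ideal_gen (range g)"
      unfolding gen[symmetric] assms(3) by (simp add: ideal.span_base)
    ultimately obtain r where r: "f = (\<Sum>i\<in>UNIV. r i * g i)" by blast
    \<comment> \<open>Every \<open>g i\<close> contains a factor \<open>f\<close>; cancelling it
      turns generation of \<open>I\<close> into unimodularity of the row
      \<open>X i + f * a i\<close>.\<close>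
    have "f * (1 - (\<Sum>i\<in>UNIV. (X i + f * a i) * r i)) = f - (\<Sum>i\<in>UNIV. r i * g i)"
      by (simp only: g right_diff_distrib sum_distrib_left mult_ac mult_1_left)
    also have "\<dots> = 0"
      unfolding r[symmetric] by simp
    finally have "quadric * (1 - (\<Sum>i\<in>UNIV. (X i + quadric * a i) * r i)) = 0"
      unfolding f .
    from quadric_mult_eq_0[OF this] have "(\<Sum>i\<in>UNIV. (X i + quadric * a i) * r i) = 1"
      by simp
    with no_unimodular_lift show False ..
  qed
qed

end
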